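(* Let $\Omega$ be a domain in $\mathbb{C}$ and let $K$ be a compact set in $\Omega$ such that $\Omega \setminus K$ has no relatively compact components in $\Omega$. Then every function $f \in \mathcal{H}_{l.u.}(K)$ can be approximated uniformly on $K$ by functions in $\mathcal{H}_{l.u.}(\Omega)$.
   Context: For a set $M \subseteq \mathbb{C}$, $\mathcal{H}_{l.u.}(M)$ denotes the family of all functions which are holomorphic and locally univalent (i.e. with nowhere vanishing derivative) on some open neighborhood of $M$ in $\mathbb{C}$; the neighborhood may depend on the function. For an open set $\Omega$ these are the holomorphic functions $f$ on $\Omega$ with $f'(z)\neq 0$ for all $z\in\Omega$. *)

theory Defs
  imports "HOL-Analysis.Analysis"
begin

text \<open>
  Functions are total in HOL, so an element of \<open>H_lu M\<close> stands for its restriction to some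
  open neighbourhood of \<open>M\<close>; its values elsewhere are irrelevant. Local univalence is
  expressed by the derivative having no zero.
\<close>

definition H_lu :: "complex set \<Rightarrow> (complex \<Rightarrow> complex) set" where
  "H_lu M = {f. \<exists>U. open U \<and> M \<subseteq> U \<and> f holomorphic_on U \<and> (\<forall>z\<in>U. deriv f z \<noteq> 0)}"

lemma H_lu_open:
  assumes "open \<Omega>"
  shows "H_lu \<Omega> = {f. f holomorphic_on \<Omega> \<and> (\<forall>z\<in>\<Omega>. deriv f z \<noteq> 0)}"
  using assms by (auto simp: H_lu_def intro: holomorphic_on_subset)

text \<open>
  The closure is taken relative to \<open>S\<close>: for an open unit disc \<open>S\<close>, the set \<open>C = S\<close> is
  bounded but not relatively compact in \<open>S\<close>.
\<close>

definition relatively_compact_in :: "'a::topological_space set \<Rightarrow> 'a set \<Rightarrow> bool" where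
  "relatively_compact_in S C \<longleftrightarrow> C \<subseteq> S \<and> compact (top_of_set S closure_of C)"

lemma relatively_compact_in_iff:
  fixes S C :: "'a::t2_space set"
  shows "relatively_compact_in S C \<longleftrightarrow> compact (closure C) \<and> closure C \<subseteq> S"
proof
  assume *: "relatively_compact_in S C"
  then have "C \<subseteq> S" and c: "compact (S \<inter> closure C)"
    by (auto simp: relatively_compact_in_def closure_of_subtopology Int_absorb1)
  then have "closure C \<subseteq> S \<inter> closure C"
    by (intro closure_minimal compact_imp_closed) (use closure_subset in auto)
  with c show "compact (closure C) \<and> closure C \<subseteq> S"
    by (metis inf.absorb_iff2 inf.boundedE)
next
  assume *: "compact (closure C) \<and> closure C \<subseteq> S"
  then have "C \<subseteq> S" using closure_subset by blast
  with * show "relatively_compact_in S C"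
    by (simp add: relatively_compact_in_def closure_of_subtopology Int_absorb1)
qed

end

theory Submission
  imports Defs "HOL-Complex_Analysis.Complex_Analysis"
begin

text \<open>
  Runge's theorem gives a rational function \<open>G\<close> with poles off \<open>\<Omega>\<close> that is close to \<open>f\<close> on a
  neighbourhood of \<open>K\<close>, so that \<open>G'\<close> has no zero on \<open>K\<close>
  (\<open>locally_univalent_rational_approx\<close>). But \<open>G'\<close> may vanish in \<open>\<Omega> - K\<close>, at finitely many
  points. These zeros are removed one after the other, each time at the cost of a small change
  of \<open>G\<close> on \<open>K\<close>.

  Write \<open>G' = (z - c) Z N\<close>, where \<open>Z\<close> is a polynomial and \<open>N\<close> is holomorphic without zeros off a
  finite set \<open>A\<close> disjoint from \<open>\<Omega>\<close>. The component of \<open>- K\<close> that contains \<open>c\<close> is unbounded or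
  contains a point \<open>a\<close> off \<open>\<Omega>\<close>; this is what the topological hypothesis says. Cut the plane along an
  arc from \<open>c\<close> to \<open>a\<close> (or to infinity) that avoids \<open>K\<close>. On every compact subset of the remaining
  domain \<open>D\<close>, which is connected because an arc does not separate the plane, \<open>z - c\<close> is a uniform
  limit of functions \<open>E\<close> that are holomorphic and without zeros off \<open>A \<union> {a}\<close>
  (\<open>linear_factor_unit_approx\<close>): logarithms of quotients \<open>(z - y) / (z - x)\<close> are approximated by
  rational functions, and these are exponentiated. The derivative \<open>Z N E\<close> then has one zero less
  and is close to \<open>G'\<close>.

  This function need not have a primitive, because its residues at the points of \<open>A \<union> {a}\<close> are only
  small. A further factor \<open>exp (\<Sum> t\<^sub>i u\<^sub>i)\<close> with small coefficients \<open>t\<^sub>i\<close> makes all of them vanish: the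
  \<open>u\<^sub>i\<close> are chosen so that the linearised problem has the identity matrix, and a contraction argument
  solves the nonlinear one (\<open>period_correction\<close>). For that the residues must be controlled by the values on
  a compact part of \<open>D\<close>. Small circles do this around the points other than \<open>a\<close>. The cut ends at
  \<open>a\<close>, so every small circle around \<open>a\<close> meets it; a large circle around everything replaces it, since the sum
  of the residues is as good as the residue at \<open>a\<close>.

  Finally, \<open>K\<close> may be disconnected, and a derivative that is controlled only on \<open>K\<close> does not control the
  function. But \<open>D\<close> is connected and the new derivative is close to \<open>G'\<close> on any prescribed
  compact subset of \<open>D\<close>, so that the new primitive is close to \<open>G\<close> on all of \<open>K\<close>
  (\<open>derivative_controls_values\<close>).
\<close>

section \<open>Rational functions and their uniform closure\<close>

text \<open>
  The equation is required off \<open>A\<close> only: at a pole the quotient has the default value \<open>0\<close>, which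
  addition and multiplication of fractions do not respect.
\<close>

definition rational_off :: "complex set \<Rightarrow> (complex \<Rightarrow> complex) set" where
  "rational_off A = {r. \<exists>p q. q \<noteq> 0 \<and> (\<forall>z. poly q z = 0 \<longrightarrow> z \<in> A) \<and>
     (\<forall>z. z \<notin> A \<longrightarrow> r z = poly p z / poly q z)}"

definition rational_closure :: "complex set \<Rightarrow> complex set \<Rightarrow> (complex \<Rightarrow> complex) set" where
  "rational_closure A K = {g. \<forall>e>0. \<exists>r\<in>rational_off A. \<forall>z\<in>K. norm (g z - r z) < e}"

lemma rational_off_poly: "(\<lambda>z. poly p z) \<in> rational_off A"
  unfolding rational_off_def by (rule CollectI, rule exI[of _ p], rule exI[of _ 1]) auto

lemma rational_off_pole:
  assumes "a \<in> A" shows "(\<lambda>z. 1 / (z - a)) \<in> rational_off A"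
  unfolding rational_off_def
  by (rule CollectI, rule exI[of _ 1], rule exI[of _ "[:-a, 1:]"]) (use assms in auto)

lemma rational_off_add:
  assumes "r \<in> rational_off A" "s \<in> rational_off A"
  shows "(\<lambda>z. r z + s z) \<in> rational_off A"
proof -
  from assms obtain p q p' q' where
    1: "q \<noteq> 0" "\<And>z. poly q z = 0 \<Longrightarrow> z \<in> A" "\<And>z. z \<notin> A \<Longrightarrow> r z = poly p z / poly q z" and
    2: "q' \<noteq> 0" "\<And>z. poly q' z = 0 \<Longrightarrow> z \<in> A" "\<And>z. z \<notin> A \<Longrightarrow> s z = poly p' z / poly q' z"
    unfolding rational_off_def by blast
  have "r z + s z = poly (p * q' + p' * q) z / poly (q * q') z" if "z \<notin> A" for z
  proof -
    have "poly q z \<noteq> 0" "poly q' z \<noteq> 0" using 1(2) 2(2) that by blast+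
    then show ?thesis using that by (simp add: 1(3) 2(3) field_simps)
  qed
  then show ?thesis
    unfolding rational_off_def
    by (intro CollectI exI[of _ "p * q' + p' * q"] exI[of _ "q * q'"]) (use 1 2 in auto)
qed

lemma rational_off_mult:
  assumes "r \<in> rational_off A" "s \<in> rational_off A"
  shows "(\<lambda>z. r z * s z) \<in> rational_off A"
proof -
  from assms obtain p q p' q' where
    1: "q \<noteq> 0" "\<And>z. poly q z = 0 \<Longrightarrow> z \<in> A" "\<And>z. z \<notin> A \<Longrightarrow> r z = poly p z / poly q z" and
    2: "q' \<noteq> 0" "\<And>z. poly q' z = 0 \<Longrightarrow> z \<in> A" "\<And>z. z \<notin> A \<Longrightarrow> s z = poly p' z / poly q' z"
    unfolding rational_off_def by blast
  have "r z * s z = poly (p * p') z / poly (q * q') z" if "z \<notin> A" for z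
    using that by (auto simp: 1(3) 2(3))
  then show ?thesis
    unfolding rational_off_def
    by (intro CollectI exI[of _ "p * p'"] exI[of _ "q * q'"]) (use 1 2 in auto)
qed

lemma rational_off_holomorphic:
  assumes "r \<in> rational_off A" shows "r holomorphic_on - A"
proof -
  from assms obtain p q where
    1: "\<And>z. poly q z = 0 \<Longrightarrow> z \<in> A" "\<And>z. z \<notin> A \<Longrightarrow> r z = poly p z / poly q z"
    unfolding rational_off_def by blast
  have "(\<lambda>z. poly p z / poly q z) holomorphic_on - A"
    by (intro holomorphic_intros) (use 1 in auto)
  then show ?thesis
    by (rule holomorphic_transform) (use 1 in auto)
qed

lemma rational_closureD:
  assumes "g \<in> rational_closure A K" "e > 0"
  shows "\<exists>r\<in>rational_off A. \<forall>z\<in>K. norm (g z - r z) < e"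
  using assms by (simp add: rational_closure_def)

lemma rational_off_subset_closure: "r \<in> rational_off A \<Longrightarrow> r \<in> rational_closure A K"
  unfolding rational_closure_def by force

lemma rational_closure_cong:
  assumes "g \<in> rational_closure A K" "\<And>z. z \<in> K \<Longrightarrow> g z = h z"
  shows "h \<in> rational_closure A K"
  using assms unfolding rational_closure_def by auto

lemma rational_closure_add:
  assumes "g \<in> rational_closure A K" "h \<in> rational_closure A K"
  shows "(\<lambda>z. g z + h z) \<in> rational_closure A K"
  unfolding rational_closure_def
proof (intro CollectI allI impI)
  fix e :: real assume "e > 0"
  then have e2: "e/2 > 0" by simp
  obtain r where r: "r \<in> rational_off A" "\<And>z. z \<in> K \<Longrightarrow> norm (g z - r z) < e/2"
    using rational_closureD[OF assms(1) e2] by auto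
  obtain s where s: "s \<in> rational_off A" "\<And>z. z \<in> K \<Longrightarrow> norm (h z - s z) < e/2"
    using rational_closureD[OF assms(2) e2] by auto
  have "norm (g z + h z - (r z + s z)) < e" if "z \<in> K" for z
    using norm_diff_triangle_ineq[of "g z" "h z" "r z" "s z"] r(2)[OF that] s(2)[OF that] by simp
  then show "\<exists>r\<in>rational_off A. \<forall>z\<in>K. norm (g z + h z - r z) < e"
    by (intro bexI[of _ "\<lambda>z. r z + s z"] rational_off_add[OF r(1) s(1)]) blast
qed

lemma rational_closure_limit:
  assumes "\<And>e. e > 0 \<Longrightarrow> \<exists>h\<in>rational_closure A K. \<forall>z\<in>K. norm (g z - h z) \<le> e"
  shows "g \<in> rational_closure A K"
  unfolding rational_closure_def
proof (intro CollectI allI impI)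
  fix e :: real assume "e > 0"
  then obtain h where h: "h \<in> rational_closure A K" "\<And>z. z \<in> K \<Longrightarrow> norm (g z - h z) \<le> e/2"
    using assms[of "e/2"] by auto
  then obtain r where r: "r \<in> rational_off A" "\<And>z. z \<in> K \<Longrightarrow> norm (h z - r z) < e/2"
    using \<open>e > 0\<close> rational_closureD[of h A K "e/2"] by auto
  have "norm (g z - r z) < e" if "z \<in> K" for z
    using norm_triangle_ineq[of "g z - h z" "h z - r z"] h(2)[OF that] r(2)[OF that] by simp
  with r show "\<exists>r\<in>rational_off A. \<forall>z\<in>K. norm (g z - r z) < e" by blast
qed

lemma rational_off_bounded:
  assumes "r \<in> rational_off A" "compact K" "K \<inter> A = {}"
  obtains B where "B > 0" "\<And>z. z \<in> K \<Longrightarrow> norm (r z) \<le> B"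
proof -
  have "compact (r ` K)"
    using assms by (intro compact_continuous_image holomorphic_on_imp_continuous_on
        holomorphic_on_subset[OF rational_off_holomorphic[OF assms(1)]]) auto
  then show ?thesis
    using that bounded_pos[of "r ` K"] compact_imp_bounded by auto
qed

text \<open>
  Functions in the closure are bounded on the compact set \<open>K\<close>, because rational functions without
  poles on \<open>K\<close> are; so multiplication is continuous for uniform convergence.
\<close>

lemma rational_closure_mult:
  assumes "g \<in> rational_closure A K" "h \<in> rational_closure A K" "compact K" "K \<inter> A = {}"
  shows "(\<lambda>z. g z * h z) \<in> rational_closure A K"
proof (rule rational_closure_limit)
  fix e :: real assume e: "e > 0"
  obtain s0 where s0: "s0 \<in> rational_off A" "\<And>z. z \<in> K \<Longrightarrow> norm (h z - s0 z) < 1"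
    using rational_closureD[OF assms(2) zero_less_one] by auto
  obtain B where B: "B > 0" "\<And>z. z \<in> K \<Longrightarrow> norm (s0 z) \<le> B"
    using rational_off_bounded[OF s0(1) assms(3,4)] by blast
  have hB: "norm (h z) \<le> B + 1" if "z \<in> K" for z
    using B(2)[OF that] s0(2)[OF that] norm_triangle_ineq[of "h z - s0 z" "s0 z"] by simp
  define d where "d = e / (2 * (B + 1))"
  have d: "d > 0" using e B by (simp add: d_def)
  obtain r where r: "r \<in> rational_off A" "\<And>z. z \<in> K \<Longrightarrow> norm (g z - r z) < d"
    using rational_closureD[OF assms(1) d] by auto
  obtain C where C: "C > 0" "\<And>z. z \<in> K \<Longrightarrow> norm (r z) \<le> C"
    using rational_off_bounded[OF r(1) assms(3,4)] by blast
  have eC: "e / (2 * C) > 0" using e C by simp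
  obtain s where s: "s \<in> rational_off A" "\<And>z. z \<in> K \<Longrightarrow> norm (h z - s z) < e / (2 * C)"
    using rational_closureD[OF assms(2) eC] by auto
  have "norm (g z * h z - r z * s z) \<le> e" if z: "z \<in> K" for z
  proof -
    have "g z * h z - r z * s z = (g z - r z) * h z + r z * (h z - s z)"
      by (simp add: algebra_simps)
    then have "norm (g z * h z - r z * s z) \<le> norm (g z - r z) * norm (h z) + norm (r z) * norm (h z - s z)"
      by (metis norm_mult norm_triangle_ineq)
    also have "\<dots> \<le> d * (B + 1) + C * (e / (2 * C))"
      using r(2)[OF z] s(2)[OF z] hB[OF z] C(2)[OF z] C(1) d
      by (intro add_mono mult_mono) auto
    also have "\<dots> = e" using B C by (simp add: d_def field_simps)
    finally show ?thesis .
  qed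
  then show "\<exists>h'\<in>rational_closure A K. \<forall>z\<in>K. norm (g z * h z - h' z) \<le> e"
    by (intro bexI[of _ "\<lambda>z. r z * s z"] rational_off_subset_closure[OF rational_off_mult[OF r(1) s(1)]]) blast
qed

lemma rational_closure_const: "(\<lambda>z. c) \<in> rational_closure A K"
  using rational_off_subset_closure[OF rational_off_poly[of "[:c:]"]] by simp

lemma rational_closure_ident: "(\<lambda>z. z) \<in> rational_closure A K"
  using rational_off_subset_closure[OF rational_off_poly[of "[:0,1:]"]] by simp

lemma rational_closure_sum:
  assumes "finite I" "\<And>i. i \<in> I \<Longrightarrow> g i \<in> rational_closure A K"
  shows "(\<lambda>z. \<Sum>i\<in>I. g i z) \<in> rational_closure A K"
  using assms
proof (induction I rule: finite_induct)
  case empty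
  show ?case by (simp add: rational_closure_const)
next
  case (insert i I)
  have "(\<lambda>z. g i z + (\<Sum>i\<in>I. g i z)) \<in> rational_closure A K"
    by (rule rational_closure_add) (use insert in auto)
  then show ?case using insert.hyps by simp
qed

lemma rational_closure_power:
  assumes "g \<in> rational_closure A K" "compact K" "K \<inter> A = {}"
  shows "(\<lambda>z. g z ^ n) \<in> rational_closure A K"
proof (induction n)
  case 0
  show ?case by (simp add: rational_closure_const)
next
  case (Suc n)
  show ?case using rational_closure_mult[OF assms(1) Suc.IH assms(2,3)] unfolding power_Suc .
qed

lemma holomorphic_disc_polynomial_approx:
  assumes h: "h holomorphic_on ball 0 R" and \<rho>: "0 \<le> \<rho>" "\<rho> < R" and "e > 0"
  shows "\<exists>n a. \<forall>x. norm x \<le> \<rho> \<longrightarrow> norm (h x - (\<Sum>i<n. a i * x ^ i)) \<le> e"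
proof -
  define a where "a = (\<lambda>n. (deriv ^^ n) h 0 / fact n)"
  have S: "(\<lambda>n. a n * x ^ n) sums h x" if "x \<in> ball 0 R" for x
    using holomorphic_power_series[OF h that] by (simp add: a_def)
  obtain \<sigma> where \<sigma>: "\<rho> < \<sigma>" "\<sigma> < R" using \<rho> dense by blast
  have "summable (\<lambda>n. a n * of_real \<sigma> ^ n)"
    using S[of "of_real \<sigma>"] \<sigma> \<rho> by (auto simp: sums_iff)
  then have "uniform_limit (cball 0 \<rho>) (\<lambda>n x. \<Sum>i<n. a i * (x - 0) ^ i) (\<lambda>x. suminf (\<lambda>i. a i * (x - 0)^i)) sequentially"
    by (intro powser_uniform_limit) (use \<sigma> \<rho> in \<open>auto intro!: less_le_trans[OF _ conv_radius_geI]\<close>)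
  from uniform_limitD[OF this \<open>e > 0\<close>] obtain n where
    "\<And>x. x \<in> cball 0 \<rho> \<Longrightarrow> dist (\<Sum>i<n. a i * x ^ i) (suminf (\<lambda>i. a i * x^i)) < e"
    unfolding eventually_sequentially diff_zero by blast
  moreover have "suminf (\<lambda>i. a i * x^i) = h x" if "x \<in> cball 0 \<rho>" for x
    using S[of x] that \<rho> by (auto simp: sums_iff)
  ultimately show ?thesis
    by (intro exI[of _ n] exI[of _ a]) (force simp: dist_norm norm_minus_commute)
qed

text \<open>
  Taylor polynomials of \<open>h\<close> converge uniformly on the smaller disc that contains all values of \<open>g\<close>, and
  the closure is an algebra. The functions \<open>1 / (1 - x)\<close> and \<open>Ln (1 - x)\<close> are the cases of interest.
\<close>

lemma rational_closure_compose:
  assumes g: "g \<in> rational_closure A K" "\<And>z. z \<in> K \<Longrightarrow> norm (g z) \<le> \<rho>"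
    and h: "h holomorphic_on ball 0 R" and \<rho>: "0 \<le> \<rho>" "\<rho> < R"
    and K: "compact K" "K \<inter> A = {}"
  shows "(\<lambda>z. h (g z)) \<in> rational_closure A K"
proof (rule rational_closure_limit)
  fix e :: real assume "e > 0"
  from holomorphic_disc_polynomial_approx[OF h \<rho> this] obtain n a where
    na: "\<And>x. norm x \<le> \<rho> \<Longrightarrow> norm (h x - (\<Sum>i<n. a i * x ^ i)) \<le> e" by blast
  have "(\<lambda>z. a i * g z ^ i) \<in> rational_closure A K" for i
    by (rule rational_closure_mult[OF rational_closure_const rational_closure_power[OF g(1) K] K])
  then have *: "(\<lambda>z. \<Sum>i<n. a i * g z ^ i) \<in> rational_closure A K"
    by (rule rational_closure_sum[OF finite_lessThan, of n "\<lambda>i z. a i * g z ^ i"])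
  show "\<exists>h'\<in>rational_closure A K. \<forall>z\<in>K. norm (h (g z) - h' z) \<le> e"
    by (rule bexI[OF _ *]) (use na g(2) in blast)
qed

section \<open>Pushing poles and zeros through the complement\<close>

text \<open>
  A pole or zero at \<open>w\<close> can be moved within \<open>S\<close> to a point of \<open>A\<close>, or so far away that
  \<open>z / b\<close> is at most \<open>1/2\<close> in absolute value on \<open>K\<close>; the latter stands for a move to infinity.
\<close>

definition pole_reachable :: "complex set \<Rightarrow> complex set \<Rightarrow> complex \<Rightarrow> bool" where
  "pole_reachable A K w \<longleftrightarrow> (\<exists>S. connected S \<and> S \<inter> K = {} \<and> w \<in> S \<and> 
     (\<exists>b\<in>S. b \<in> A \<or> (\<forall>z\<in>K. 2 * norm z < norm b)))"

text \<open>
  The connected set \<open>S\<close> avoids the compact set \<open>K\<close>, so each of its points has a neighbourhood on which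
  any two points are much closer to each other than to \<open>K\<close>. A property that survives such short moves is
  therefore constant on \<open>S\<close>.
\<close>

lemma pole_reachable_induct:
  fixes P :: "complex \<Rightarrow> bool"
  assumes "compact K" "pole_reachable A K w"
    and base: "\<And>b. b \<notin> K \<Longrightarrow> b \<in> A \<or> (\<forall>z\<in>K. 2 * norm z < norm b) \<Longrightarrow> P b"
    and step: "\<And>x y. x \<notin> K \<Longrightarrow> y \<notin> K \<Longrightarrow> (\<And>z. z \<in> K \<Longrightarrow> 2 * norm (y - x) \<le> norm (z - x)) \<Longrightarrow> P x \<Longrightarrow> P y"
  shows "P w"
proof -
  from assms(2) obtain S b where S: "connected S" "S \<inter> K = {}" "w \<in> S" "b \<in> S"
    "b \<in> A \<or> (\<forall>z\<in>K. 2 * norm z < norm b)"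
    unfolding pole_reachable_def by blast
  show ?thesis
  proof (rule connected_induction_simple[OF S(1) S(4) S(3)])
    show "P b" using base S by blast
    fix x assume x: "x \<in> S"
    have "open (- K)" using compact_imp_closed[OF assms(1)] by (rule open_Compl)
    moreover have "x \<in> - K" using x S(2) by blast
    ultimately obtain d where d: "d > 0" "ball x d \<subseteq> - K"
      by (meson open_contains_ball)
    show "\<exists>T. openin (top_of_set S) T \<and> x \<in> T \<and> (\<forall>u\<in>T. \<forall>v\<in>T. P u \<longrightarrow> P v)"
    proof (intro exI conjI ballI impI)
      show "openin (top_of_set S) (S \<inter> ball x (d/5))" by auto
      show "x \<in> S \<inter> ball x (d/5)" using x d by auto
      fix u v assume uv: "u \<in> S \<inter> ball x (d/5)" "v \<in> S \<inter> ball x (d/5)" "P u"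
      show "P v"
      proof (rule step[OF _ _ _ uv(3)])
        show "u \<notin> K" "v \<notin> K" using uv S by auto
        fix z assume z: "z \<in> K"
        then have "d \<le> dist x z" using d by (meson ComplD mem_ball not_le subsetD)
        moreover have "dist x u < d/5" "dist x v < d/5" using uv by auto
        moreover have "dist x z \<le> dist x u + dist u z" "dist v u \<le> dist x v + dist x u"
          by (metis dist_triangle, metis dist_commute dist_triangle)
        ultimately have "2 * dist v u \<le> dist u z" by linarith
        then show "2 * norm (v - u) \<le> norm (z - u)" by (simp add: dist_norm norm_minus_commute)
      qed
    qed
  qed
qed

text \<open>
  For a short move from \<open>x\<close> to \<open>y\<close> the geometric series in \<open>(y - x) / (z - x)\<close> expresses the kernel at
  \<open>y\<close> by the kernel at \<open>x\<close>. Far away the geometric series in \<open>z / b\<close> gives polynomials.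
\<close>

lemma cauchy_kernel_in_closure:
  assumes K: "compact K" "K \<inter> A = {}" and w: "pole_reachable A K w"
  shows "(\<lambda>z. 1 / (z - w)) \<in> rational_closure A K"
  using K(1) w
proof (rule pole_reachable_induct)
  have inv: "(\<lambda>x. 1 / (1 - x)) holomorphic_on ball 0 1"
    by (intro holomorphic_intros) auto
  fix b assume b: "b \<notin> K" "b \<in> A \<or> (\<forall>z\<in>K. 2 * norm z < norm b)"
  show "(\<lambda>z. 1 / (z - b)) \<in> rational_closure A K"
  proof (cases "b \<in> A")
    case True then show ?thesis by (intro rational_off_subset_closure rational_off_pole)
  next
    case False
    then have far: "\<And>z. z \<in> K \<Longrightarrow> 2 * norm z < norm b" using b by blast
    show ?thesis
    proof (cases "b = 0")
      case True
      then have "K = {}" using far by force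
      then show ?thesis by (auto intro: rational_closure_cong[OF rational_closure_const])
    next
      case b0: False
      have "(\<lambda>z. (1/b) * z) \<in> rational_closure A K"
        by (rule rational_closure_mult[OF rational_closure_const rational_closure_ident K])
      then have "(\<lambda>z. 1 / (1 - (1/b) * z)) \<in> rational_closure A K"
      proof (rule rational_closure_compose[OF _ _ inv, where \<rho> = "1/2"])
        show "norm ((1/b) * z) \<le> 1/2" if "z \<in> K" for z
          using far[OF that] b0 by (simp add: norm_divide norm_mult divide_simps)
      qed (use K in auto)
      then have "(\<lambda>z. (-1/b) * (1 / (1 - (1/b) * z))) \<in> rational_closure A K"
        by (intro rational_closure_mult rational_closure_const K)
      then show ?thesis
      proof (rule rational_closure_cong)
        fix z assume "z \<in> K"
        then have "z \<noteq> b" using b by auto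
        moreover have "1 - (1/b) * z = (b - z) / b" using b0 by (simp add: field_simps)
        ultimately show "(-1/b) * (1 / (1 - (1/b) * z)) = 1 / (z - b)"
          using b0 by (simp add: field_simps)
      qed
    qed
  qed
next
  have inv: "(\<lambda>x. 1 / (1 - x)) holomorphic_on ball 0 1"
    by (intro holomorphic_intros) auto
  fix x y assume xy: "x \<notin> K" "y \<notin> K" "\<And>z. z \<in> K \<Longrightarrow> 2 * norm (y - x) \<le> norm (z - x)"
    and x: "(\<lambda>z. 1 / (z - x)) \<in> rational_closure A K"
  have "(\<lambda>z. 1 / (1 - (y - x) * (1 / (z - x)))) \<in> rational_closure A K"
  proof (rule rational_closure_compose[OF _ _ inv, where \<rho> = "1/2"])
    show "(\<lambda>z. (y - x) * (1 / (z - x))) \<in> rational_closure A K"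
      by (intro rational_closure_mult rational_closure_const K x)
    show "norm ((y - x) * (1 / (z - x))) \<le> 1/2" if "z \<in> K" for z
      using xy(3)[OF that] xy(1) that by (auto simp: norm_divide norm_mult divide_simps)
  qed (use K in auto)
  then have "(\<lambda>z. (1 / (z - x)) * (1 / (1 - (y - x) * (1 / (z - x))))) \<in> rational_closure A K"
    by (intro rational_closure_mult x K)
  then show "(\<lambda>z. 1 / (z - y)) \<in> rational_closure A K"
  proof (rule rational_closure_cong)
    fix z assume "z \<in> K"
    then have "z \<noteq> x" "z \<noteq> y" using xy by auto
    moreover have "1 - (y - x) * (1 / (z - x)) = (z - y) / (z - x)"
      using \<open>z \<noteq> x\<close> by (simp add: field_simps)
    ultimately show "1 / (z - x) * (1 / (1 - (y - x) * (1 / (z - x)))) = 1 / (z - y)"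
      by simp
  qed
qed

text \<open>
  The analogue of pole pushing for zeros. A short move multiplies \<open>z - x\<close> by
  \<open>(z - y) / (z - x) = exp (Ln (1 - q))\<close> with \<open>q = (y - x) / (z - x)\<close>, and the logarithm is a uniform limit
  of rational functions with poles in \<open>A\<close>. Their exponentials have no zeros. The moves start at a point
  \<open>b\<close> of \<open>A\<close>, where \<open>z - b\<close> itself has no zero off \<open>A\<close>, or far away, where \<open>z - b\<close> is \<open>- b\<close> times an exponential.
\<close>

lemma linear_factor_unit_approx:
  assumes K: "compact K" "K \<inter> A = {}" and w: "pole_reachable A K w" and "e > 0"
  obtains E where "E holomorphic_on - A" "\<And>z. z \<notin> A \<Longrightarrow> E z \<noteq> 0" 
    "\<And>z. z \<in> K \<Longrightarrow> norm (E z / (z - w) - 1) < e"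
proof -
  have lnhol: "(\<lambda>x. Ln (1 - x)) holomorphic_on ball 0 1"
  proof (intro holomorphic_intros)
    fix z :: complex assume "z \<in> ball 0 1"
    then have "Re z < 1" using complex_Re_le_cmod[of z] by simp
    then show "1 - z \<notin> \<real>\<^sub>\<le>\<^sub>0" by (auto simp: complex_nonpos_Reals_iff)
  qed
  have main: "\<exists>E. E holomorphic_on - A \<and> (\<forall>z. z \<notin> A \<longrightarrow> E z \<noteq> 0) \<and> (\<forall>z\<in>K. norm (E z / (z - y) - 1) < e)"
    if q: "q \<in> rational_closure A K" "\<And>z. z \<in> K \<Longrightarrow> norm (q z) \<le> 1/2" and y: "y \<notin> K"
      and F: "\<And>e. e > 0 \<Longrightarrow> \<exists>F. F holomorphic_on - A \<and> (\<forall>z. z \<notin> A \<longrightarrow> F z \<noteq> 0) \<and> (\<forall>z\<in>K. norm (F z * (1 - q z) / (z - y) - 1) < e)"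
      and e: "e > 0" for q y e
  proof -
    have L: "(\<lambda>z. Ln (1 - q z)) \<in> rational_closure A K"
      by (rule rational_closure_compose[OF q lnhol]) (use K in auto)
    have "isCont (\<lambda>p :: complex \<times> complex. (1 + fst p) * exp (snd p)) (0, 0)"
      by (intro continuous_intros)
    from this[unfolded continuous_at_eps_delta, rule_format, OF e] obtain d where d: "d > 0"
      "\<And>p :: complex \<times> complex. dist p (0,0) < d \<Longrightarrow> dist ((1 + fst p) * exp (snd p)) 1 < e"
      by auto
    have d2: "norm ((1 + u) * exp v - 1) < e" if "norm u < d/2" "norm v < d/2" for u v :: complex
    proof -
      have "dist (u, v) (0, 0) \<le> norm u + norm v"
        by (simp add: dist_Pair_Pair sqrt_sum_squares_le_sum)
      with d(2)[of "(u, v)"] that show ?thesis by (simp add: dist_norm)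
    qed
    \<comment> \<open>With \<open>F\<close> close to \<open>(z - y) / (1 - q z)\<close>, the product of \<open>F\<close> with an approximation of \<open>1 - q z\<close> is close to \<open>z - y\<close>.\<close>
    obtain F where F: "F holomorphic_on - A" "\<And>z. z \<notin> A \<Longrightarrow> F z \<noteq> 0" "\<And>z. z \<in> K \<Longrightarrow> norm (F z * (1 - q z) / (z - y) - 1) < d/2"
      using F[of "d/2"] d by auto
    obtain r where r: "r \<in> rational_off A" "\<And>z. z \<in> K \<Longrightarrow> norm (Ln (1 - q z) - r z) < d/2"
      using d(1) rational_closureD[OF L, of "d/2"] by auto
    show ?thesis
    proof (intro exI conjI allI impI ballI)
      show "(\<lambda>z. F z * exp (r z)) holomorphic_on - A"
        by (intro holomorphic_intros F rational_off_holomorphic r)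
      show "F z * exp (r z) \<noteq> 0" if "z \<notin> A" for z using F(2)[OF that] by simp
      fix z assume z: "z \<in> K"
      have "1 - q z \<noteq> 0" using q(2)[OF z] by auto
      then have "exp (r z) = (1 - q z) * exp (r z - Ln (1 - q z))"
        by (simp add: exp_diff)
      then have eq: "F z * exp (r z) / (z - y) = (1 + (F z * (1 - q z) / (z - y) - 1)) * exp (r z - Ln (1 - q z))"
        by simp
      have "norm (r z - Ln (1 - q z)) < d/2" using r(2)[OF z] by (simp add: norm_minus_commute)
      then show "norm (F z * exp (r z) / (z - y) - 1) < e"
        unfolding eq by (rule d2[OF F(3)[OF z]])
    qed
  qed
  have "(\<lambda>z. 1 / (z - w)) \<in> rational_closure A K \<and>
    (\<forall>e>0. \<exists>E. E holomorphic_on - A \<and> (\<forall>z. z \<notin> A \<longrightarrow> E z \<noteq> 0) \<and> (\<forall>z\<in>K. norm (E z / (z - w) - 1) < e))"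
    using K(1) w
  proof (rule pole_reachable_induct)
    fix b assume b: "b \<notin> K" "b \<in> A \<or> (\<forall>z\<in>K. 2 * norm z < norm b)"
    show "(\<lambda>z. 1 / (z - b)) \<in> rational_closure A K \<and>
      (\<forall>e>0. \<exists>E. E holomorphic_on - A \<and> (\<forall>z. z \<notin> A \<longrightarrow> E z \<noteq> 0) \<and> (\<forall>z\<in>K. norm (E z / (z - b) - 1) < e))"
    proof (intro conjI allI impI)
      have "pole_reachable A K b"
        unfolding pole_reachable_def by (rule exI[of _ "{b}"]) (use b in auto)
      then show "(\<lambda>z. 1 / (z - b)) \<in> rational_closure A K"
        by (rule cauchy_kernel_in_closure[OF K])
      fix e :: real assume e: "e > 0"
      show "\<exists>E. E holomorphic_on - A \<and> (\<forall>z. z \<notin> A \<longrightarrow> E z \<noteq> 0) \<and> (\<forall>z\<in>K. norm (E z / (z - b) - 1) < e)"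
      proof (cases "b \<in> A \<or> K = {}")
        case True
        then consider "b \<in> A" | "K = {}" by blast
        then show ?thesis
        proof cases
          case 1
          then show ?thesis
            by (intro exI[of _ "\<lambda>z. z - b"] conjI holomorphic_intros) (use b e in auto)
        next
          case 2 then show ?thesis
            by (intro exI[of _ "\<lambda>z. 1"] conjI holomorphic_intros) auto
        qed
      next
        case False
        then have far: "\<And>z. z \<in> K \<Longrightarrow> 2 * norm z < norm b" using b by blast
        have b0: "b \<noteq> 0" using far False by force
        show ?thesis
        proof (rule main[where q = "\<lambda>z. (1/b) * z", OF _ _ b(1) _ e])
          show "(\<lambda>z. (1/b) * z) \<in> rational_closure A K"
            by (rule rational_closure_mult[OF rational_closure_const rational_closure_ident K])
          show "norm ((1/b) * z) \<le> 1/2" if "z \<in> K" for z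
            using far[OF that] b0 by (simp add: norm_divide norm_mult divide_simps)
          show "\<exists>F. F holomorphic_on - A \<and> (\<forall>z. z \<notin> A \<longrightarrow> F z \<noteq> 0) \<and>
              (\<forall>z\<in>K. norm (F z * (1 - (1/b) * z) / (z - b) - 1) < e)" if "e > 0" for e
          proof (intro exI[of _ "\<lambda>z. - b"] conjI ballI)
            fix z assume "z \<in> K"
            then have "z \<noteq> b" using b by auto
            then have "- b * (1 - (1/b) * z) / (z - b) = 1" using b0 by (simp add: field_simps)
            then show "norm (- b * (1 - (1/b) * z) / (z - b) - 1) < e" using that by simp
          qed (use b0 in auto)
        qed
      qed
    qed
  next
    fix x y assume xy: "x \<notin> K" "y \<notin> K" "\<And>z. z \<in> K \<Longrightarrow> 2 * norm (y - x) \<le> norm (z - x)"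
      and x: "(\<lambda>z. 1 / (z - x)) \<in> rational_closure A K \<and>
      (\<forall>e>0. \<exists>E. E holomorphic_on - A \<and> (\<forall>z. z \<notin> A \<longrightarrow> E z \<noteq> 0) \<and> (\<forall>z\<in>K. norm (E z / (z - x) - 1) < e))"
    let ?q = "\<lambda>z. (y - x) * (1 / (z - x))"
    have q: "?q \<in> rational_closure A K"
      using x by (intro rational_closure_mult rational_closure_const K) auto
    have q2: "norm (?q z) \<le> 1/2" if "z \<in> K" for z
      using xy(3)[OF that] xy(1) that by (auto simp: norm_divide norm_mult divide_simps)
    have eq: "1 - ?q z = (z - y) / (z - x)" if "z \<in> K" for z
    proof -
      have "z \<noteq> x" using that xy by auto
      then show ?thesis by (simp add: field_simps)
    qed
    have inv: "(\<lambda>x. 1 / (1 - x)) holomorphic_on ball 0 1"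
      by (intro holomorphic_intros) auto
    have "(\<lambda>z. 1 / (1 - ?q z)) \<in> rational_closure A K"
      by (rule rational_closure_compose[OF q q2 inv]) (use K in auto)
    then have "(\<lambda>z. (1 / (z - x)) * (1 / (1 - ?q z))) \<in> rational_closure A K"
      using x by (intro rational_closure_mult K) auto
    then have 1: "(\<lambda>z. 1 / (z - y)) \<in> rational_closure A K"
    proof (rule rational_closure_cong)
      fix z assume z: "z \<in> K"
      then have "z \<noteq> x" "z \<noteq> y" using xy by auto
      then show "1 / (z - x) * (1 / (1 - ?q z)) = 1 / (z - y)"
        unfolding eq[OF z] by simp
    qed
    have 2: "\<exists>F. F holomorphic_on - A \<and> (\<forall>z. z \<notin> A \<longrightarrow> F z \<noteq> 0) \<and>
        (\<forall>z\<in>K. norm (F z * (1 - ?q z) / (z - y) - 1) < e)" if e0: "e > 0" for e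
    proof -
      obtain F where F: "F holomorphic_on - A" "\<And>z. z \<notin> A \<Longrightarrow> F z \<noteq> 0"
        "\<And>z. z \<in> K \<Longrightarrow> norm (F z / (z - x) - 1) < e" using x e0 by blast
      have "norm (F z * (1 - ?q z) / (z - y) - 1) < e" if z: "z \<in> K" for z
      proof -
        have "z \<noteq> y" using xy z by auto
        then have "F z * (1 - ?q z) / (z - y) = F z / (z - x)"
          unfolding eq[OF z] by simp
        then show ?thesis using F(3)[OF z] by simp
      qed
      with F show ?thesis by blast
    qed
    from 1 main[OF q q2 xy(2) 2]
    show "(\<lambda>z. 1 / (z - y)) \<in> rational_closure A K \<and>
      (\<forall>e>0. \<exists>E. E holomorphic_on - A \<and> (\<forall>z. z \<notin> A \<longrightarrow> E z \<noteq> 0) \<and> (\<forall>z\<in>K. norm (E z / (z - y) - 1) < e))"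
      by blast
  qed
  with \<open>e > 0\<close> that show ?thesis by blast
qed

section \<open>Cauchy's formula for a compact set\<close>

definition grid_point :: "real \<Rightarrow> int \<Rightarrow> int \<Rightarrow> complex" where
  "grid_point d m n = Complex (of_int m * d) (of_int n * d)"

text \<open>
  Closed cells, indexed by their lower left corner: a point on a grid line belongs to several.
\<close>

definition grid_cell :: "real \<Rightarrow> int \<times> int \<Rightarrow> complex set" where
  "grid_cell d p = cbox (grid_point d (fst p) (snd p)) (grid_point d (fst p + 1) (snd p + 1))"

lemma contour_integral_rectpath:
  fixes a b :: complex
  defines "a' \<equiv> Complex (Re b) (Im a)" and "b' \<equiv> Complex (Re a) (Im b)"
  assumes "continuous_on (path_image (rectpath a b)) F"
  shows "contour_integral (rectpath a b) F =
    contour_integral (linepath a a') F + contour_integral (linepath a' b) F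
    - contour_integral (linepath b' b) F - contour_integral (linepath a b') F"
proof -
  have pi: "path_image (rectpath a b) =
      closed_segment a a' \<union> closed_segment a' b \<union> closed_segment b b' \<union> closed_segment b' a"
    by (simp add: rectpath_def Let_def path_image_join a'_def b'_def Un_assoc)
  have c: "F contour_integrable_on linepath a a'" "F contour_integrable_on linepath a' b"
    "F contour_integrable_on linepath b b'" "F contour_integrable_on linepath b' a"
    using assms(3) unfolding pi
    by (auto intro!: contour_integrable_continuous_linepath elim: continuous_on_subset)
  have "contour_integral (rectpath a b) F =
    contour_integral (linepath a a') F + (contour_integral (linepath a' b) F
    + (contour_integral (linepath b b') F + contour_integral (linepath b' a) F))"
    unfolding rectpath_def Let_def a'_def[symmetric] b'_def[symmetric]
    using c by (simp add: valid_path_join contour_integrable_join)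
  also have "contour_integral (linepath b b') F = - contour_integral (linepath b' b) F"
    by (rule contour_integral_reverse_linepath) (rule continuous_on_subset[OF assms(3)], auto simp: pi)
  also have "contour_integral (linepath b' a) F = - contour_integral (linepath a b') F"
    by (rule contour_integral_reverse_linepath) (rule continuous_on_subset[OF assms(3)], auto simp: pi)
  finally show ?thesis by simp
qed

text \<open>
  Each inner edge of a union of grid cells is traversed once in either direction. With \<open>h p\<close> the integral
  along the edge of cell \<open>p\<close> and \<open>s\<close> the shift to the neighbouring cell, what is left are the
  edges that belong to exactly one cell of \<open>S\<close>.
\<close>

lemma sum_shift_cancel:
  fixes h :: "'a \<Rightarrow> 'b::ab_group_add"
  assumes "finite S" "inj s"
  shows "(\<Sum>p\<in>S. h p - h (s p)) = (\<Sum>p\<in>S - s ` S. h p) - (\<Sum>p\<in>s ` S - S. h p)"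
proof -
  have "(\<Sum>p\<in>S. h (s p)) = (\<Sum>p\<in>s ` S. h p)"
    by (subst sum.reindex) (use assms in \<open>auto intro: inj_on_subset\<close>)
  moreover have "(\<Sum>p\<in>S. h p) = (\<Sum>p\<in>S - s ` S. h p) + (\<Sum>p\<in>S \<inter> s ` S. h p)"
    using assms(1) by (metis add.commute sum.Int_Diff)
  moreover have "(\<Sum>p\<in>s ` S. h p) = (\<Sum>p\<in>s ` S - S. h p) + (\<Sum>p\<in>S \<inter> s ` S. h p)"
    using assms(1) by (metis add.commute sum.Int_Diff finite_imageI Int_commute)
  ultimately show ?thesis by (simp add: sum_subtractf)
qed

lemma grid_cell_disjoint:
  assumes "d > 0" "z \<in> box (grid_point d m n) (grid_point d (m+1) (n+1))" "z \<in> grid_cell d q"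
  shows "q = (m, n)"
proof -
  have *: "i = j" if "of_int i * d < x" "x < (of_int i + 1) * d" "of_int j * d \<le> x" "x \<le> (of_int j + 1) * d" for i j :: int and x :: real
  proof -
    have "of_int i * d < (of_int j + 1) * d" "of_int j * d < (of_int i + 1) * d" using that by linarith+
    then have "real_of_int i < of_int j + 1" "real_of_int j < of_int i + 1" using assms(1) by auto
    then show ?thesis by linarith
  qed
  show ?thesis
    using assms(2,3) *[of m "Re z" "fst q"] *[of n "Im z" "snd q"]
    by (auto simp: grid_cell_def grid_point_def in_box_complex_iff in_cbox_complex_iff prod_eq_iff)
qed

lemma grid_cell_exists:
  assumes "d > 0" obtains p where "z \<in> grid_cell d p"
proof
  show "z \<in> grid_cell d (\<lfloor>Re z / d\<rfloor>, \<lfloor>Im z / d\<rfloor>)"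
    using assms floor_divide_lower[OF assms, of "Re z"] floor_divide_upper[OF assms, of "Re z"]
      floor_divide_lower[OF assms, of "Im z"] floor_divide_upper[OF assms, of "Im z"]
    by (auto simp: grid_cell_def grid_point_def in_cbox_complex_iff)
qed

lemma grid_cell_diam:
  assumes "z \<in> grid_cell d p" "w \<in> grid_cell d p"
  shows "norm (z - w) \<le> 2 * d"
proof -
  have "norm (z - w) \<le> \<bar>Re (z - w)\<bar> + \<bar>Im (z - w)\<bar>" by (rule cmod_le)
  also have "\<dots> \<le> d + d"
    using assms by (intro add_mono) (auto simp: grid_cell_def grid_point_def in_cbox_complex_iff algebra_simps)
  finally show ?thesis by simp
qed

lemma finite_grid_cells:
  assumes "d > 0" "bounded K"
  shows "finite {p. grid_cell d p \<inter> K \<noteq> {}}"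
proof -
  obtain R where R: "\<And>z. z \<in> K \<Longrightarrow> norm z \<le> R" using assms(2) bounded_iff by blast
  define N where "N = \<lceil>R / d\<rceil> + 1"
  have *: "m \<in> {-N..N}" if "of_int m * d \<le> x" "x \<le> (of_int m + 1) * d" "\<bar>x\<bar> \<le> R" for m :: int and x :: real
  proof -
    have "of_int m \<le> x / d" "x / d \<le> of_int m + 1" "x / d \<le> R / d" "- (R / d) \<le> x / d"
      using that assms(1) by (auto simp: field_simps)
    moreover have "R / d \<le> of_int \<lceil>R / d\<rceil>" by simp
    ultimately have "real_of_int m \<le> of_int N" "- real_of_int N \<le> of_int m" unfolding N_def by linarith+
    then show ?thesis by simp
  qed
  have "{p. grid_cell d p \<inter> K \<noteq> {}} \<subseteq> {-N..N} \<times> {-N..N}"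
  proof
    fix p assume "p \<in> {p. grid_cell d p \<inter> K \<noteq> {}}"
    then obtain z where z: "z \<in> grid_cell d p" "z \<in> K" by blast
    have "\<bar>Re z\<bar> \<le> R" "\<bar>Im z\<bar> \<le> R"
      using R[OF z(2)] abs_Re_le_cmod[of z] abs_Im_le_cmod[of z] by linarith+
    moreover have "of_int (fst p) * d \<le> Re z" "Re z \<le> (of_int (fst p) + 1) * d"
      "of_int (snd p) * d \<le> Im z" "Im z \<le> (of_int (snd p) + 1) * d"
      using z(1) by (auto simp: grid_cell_def grid_point_def in_cbox_complex_iff)
    ultimately have "fst p \<in> {-N..N}" "snd p \<in> {-N..N}" using * by blast+
    then show "p \<in> {-N..N} \<times> {-N..N}" by (simp add: mem_Times_iff)
  qed
  then show ?thesis by (rule finite_subset) auto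
qed

text \<open>
  Needed for points on the grid lines, where the formula is a limit of the formula inside the cells.
\<close>

lemma continuous_cauchy_segment:
  assumes "continuous_on (closed_segment a b) f" "z \<notin> closed_segment a b"
  shows "isCont (\<lambda>z. contour_integral (linepath a b) (\<lambda>w. f w / (w - z))) z"
proof -
  have "((\<lambda>z. contour_integral (linepath a b) (\<lambda>w. f w / (w - z))) has_field_derivative
    (of_nat 1 * contour_integral (linepath a b) (\<lambda>u. f u / (u - z) ^ Suc 1))) (at z)"
  proof (rule Cauchy_next_derivative(2)[where S = UNIV and k = 1 and B = "norm (b - a)"])
    show "((\<lambda>u. f u / (u - w) ^ 1) has_contour_integral contour_integral (linepath a b) (\<lambda>w'. f w' / (w' - w))) (linepath a b)"
      if "w \<in> UNIV - path_image (linepath a b)" for w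
    proof -
      have "(\<lambda>u. f u / (u - w)) contour_integrable_on linepath a b"
        by (intro contour_integrable_continuous_linepath continuous_intros assms) (use that in auto)
      then show ?thesis by (simp add: has_contour_integral_integral)
    qed
  qed (use assms in auto)
  then show ?thesis by (rule DERIV_isCont)
qed

lemma grid_cell_cauchy:
  fixes d :: real and p :: "int \<times> int"
  defines "R \<equiv> rectpath (grid_point d (fst p) (snd p)) (grid_point d (fst p + 1) (snd p + 1))"
  assumes "d > 0" "f holomorphic_on grid_cell d p"
    and z: "z \<in> box (grid_point d m n) (grid_point d (m+1) (n+1))"
  shows "contour_integral R (\<lambda>w. f w / (w - z)) = (if p = (m, n) then 2 * pi * \<i> * f z else 0)"
    and "z \<notin> path_image R" 
proof -
  let ?a = "grid_point d (fst p) (snd p)" and ?b = "grid_point d (fst p + 1) (snd p + 1)"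
  have ab: "Re ?a \<le> Re ?b" "Im ?a \<le> Im ?b" "Re ?a < Re ?b" "Im ?a < Im ?b"
    using assms(2) by (auto simp: grid_point_def algebra_simps)
  have img: "path_image R = grid_cell d p - box ?a ?b"
    unfolding R_def grid_cell_def by (rule path_image_rectpath_cbox_minus_box[OF ab(1,2)])
  show nz: "z \<notin> path_image R"
    using grid_cell_disjoint[OF assms(2) z, of p] z unfolding img by auto
  show "contour_integral R (\<lambda>w. f w / (w - z)) = (if p = (m, n) then 2 * pi * \<i> * f z else 0)"
  proof (cases "p = (m, n)")
    case True
    then have zb: "z \<in> box ?a ?b" using z by simp
    have "((\<lambda>w. f w / (w - z)) has_contour_integral (2 * pi * \<i> * winding_number R z * f z)) R"
      by (rule Cauchy_integral_formula_convex_simple[OF _ assms(3)])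
        (use zb nz img in \<open>auto simp: R_def grid_cell_def interior_cbox\<close>)
    moreover have "winding_number R z = 1"
      unfolding R_def by (rule winding_number_rectpath[OF zb])
    ultimately show ?thesis using True by (simp add: contour_integral_unique)
  next
    case False
    then have "z \<notin> grid_cell d p" using grid_cell_disjoint[OF assms(2) z] by blast
    then have "(\<lambda>w. f w / (w - z)) holomorphic_on grid_cell d p"
      by (intro holomorphic_intros assms) auto
    then have "((\<lambda>w. f w / (w - z)) has_contour_integral 0) R"
      by (rule Cauchy_theorem_convex_simple) (use img in \<open>auto simp: R_def grid_cell_def\<close>)
    then show ?thesis using False by (simp add: contour_integral_unique)
  qed
qed

text \<open>
  The grid form of the Cauchy formula. Sum the integrals over the boundaries of all cells that meet \<open>K\<close>.
  Inner edges cancel; an edge that remains belongs to one cell that meets \<open>K\<close> and one that does not,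
  so it is disjoint from \<open>K\<close>.
\<close>

theorem cauchy_formula_compact:
  assumes K: "compact K" and U: "open U" "K \<subseteq> U"
  obtains es :: "(complex \<times> complex) list" where
    "\<And>a b. (a, b) \<in> set es \<Longrightarrow> closed_segment a b \<subseteq> U - K"
    "\<And>f z. f holomorphic_on U \<Longrightarrow> z \<in> K \<Longrightarrow>
      2 * pi * \<i> * f z = (\<Sum>(a, b)\<leftarrow>es. contour_integral (linepath a b) (\<lambda>w. f w / (w - z)))"
proof -
  obtain e where e: "e > 0" "\<And>x y. x \<in> K \<Longrightarrow> dist x y < e \<Longrightarrow> y \<in> U"
  proof -
    have "compact K \<and> K \<subseteq> \<Union>{U}" using K U by auto
    then obtain e where "0 < e" "\<And>x. x \<in> K \<Longrightarrow> \<exists>G\<in>{U}. ball x e \<subseteq> G"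
      using Heine_Borel_lemma[of K "{U}"] U by blast
    then show ?thesis using that[of e] by (auto simp: subset_iff)
  qed
  define d where "d = e / 3"
  have d: "d > 0" "2 * d < e" using e by (auto simp: d_def)
  define S where "S = {p. grid_cell d p \<inter> K \<noteq> {}}"
  have finS: "finite S" unfolding S_def by (rule finite_grid_cells) (use d K compact_imp_bounded in auto)
  have SU: "grid_cell d p \<subseteq> U" if pS: "p \<in> S" for p
  proof
    fix y assume "y \<in> grid_cell d p"
    moreover obtain x where "x \<in> grid_cell d p" "x \<in> K" using pS unfolding S_def by blast
    ultimately show "y \<in> U" using grid_cell_diam[of x d p y] d e(2)[of x y] by (simp add: dist_norm)
  qed
  define P where "P = (\<lambda>p. grid_point d (fst p) (snd p))"
  define up where "up = (\<lambda>p :: int \<times> int. (fst p, snd p + 1))"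
  define rt where "rt = (\<lambda>p :: int \<times> int. (fst p + 1, snd p))"
  have inj: "inj up" "inj rt" by (auto simp: inj_def up_def rt_def prod_eq_iff)
  have edge: "closed_segment (P p) (P (rt p)) \<subseteq> grid_cell d p" "closed_segment (P p) (P (up p)) \<subseteq> grid_cell d p"
    "closed_segment (P (up p)) (P (rt (up p))) \<subseteq> grid_cell d p" "closed_segment (P (rt p)) (P (up (rt p))) \<subseteq> grid_cell d p" for p
    by (rule closed_segment_subset; use d in \<open>auto simp: P_def up_def rt_def grid_cell_def grid_point_def in_cbox_complex_iff algebra_simps\<close>)+
  obtain h1 h2 v1 v2 where lists:
    "set h1 = S - up ` S" "distinct h1" "set h2 = up ` S - S" "distinct h2"
    "set v1 = rt ` S - S" "distinct v1" "set v2 = S - rt ` S" "distinct v2"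
    using finS by (metis finite_Diff finite_distinct_list finite_imageI)
  define es where "es = map (\<lambda>p. (P p, P (rt p))) h1 @ map (\<lambda>p. (P (rt p), P p)) h2
     @ map (\<lambda>p. (P p, P (up p))) v1 @ map (\<lambda>p. (P (up p), P p)) v2"
  \<comment> \<open>The horizontal edge of cell \<open>p\<close> also bounds the cell \<open>q\<close> below it; for a remaining edge exactly one of the two meets \<open>K\<close>.\<close>
  have Hedge: "closed_segment (P p) (P (rt p)) \<subseteq> U - K" if p: "p \<in> S - up ` S \<or> p \<in> up ` S - S" for p
  proof -
    obtain q where q: "p = up q" by (metis (no_types, lifting) diff_add_cancel fst_conv prod.collapse snd_conv up_def)
    have "closed_segment (P p) (P (rt p)) \<subseteq> grid_cell d p \<inter> grid_cell d q"
      using edge(1)[of p] edge(3)[of q] q by blast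
    moreover have "(p \<in> S \<and> q \<notin> S) \<or> (p \<notin> S \<and> q \<in> S)"
      using p unfolding q by (auto simp: inj_image_mem_iff[OF inj(1)])
    ultimately show ?thesis using SU[of p] SU[of q] by (auto simp: S_def)
  qed
  have Vedge: "closed_segment (P p) (P (up p)) \<subseteq> U - K" if p: "p \<in> S - rt ` S \<or> p \<in> rt ` S - S" for p
  proof -
    obtain q where q: "p = rt q" by (metis (no_types, lifting) diff_add_cancel fst_conv prod.collapse snd_conv rt_def)
    have "closed_segment (P p) (P (up p)) \<subseteq> grid_cell d p \<inter> grid_cell d q"
      using edge(2)[of p] edge(4)[of q] q by blast
    moreover have "(p \<in> S \<and> q \<notin> S) \<or> (p \<notin> S \<and> q \<in> S)"
      using p unfolding q by (auto simp: inj_image_mem_iff[OF inj(2)])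
    ultimately show ?thesis using SU[of p] SU[of q] by (auto simp: S_def)
  qed
  have esU: "closed_segment a b \<subseteq> U - K" if "(a, b) \<in> set es" for a b
    using that unfolding es_def set_append set_map lists
  proof (elim UnE imageE)
    fix q assume "(a, b) = (P q, P (rt q))" "q \<in> S - up ` S"
    then show ?thesis using Hedge[of q] by simp
  next
    fix q assume "(a, b) = (P (rt q), P q)" "q \<in> up ` S - S"
    then show ?thesis using Hedge[of q] by (subst closed_segment_commute) simp
  next
    fix q assume "(a, b) = (P q, P (up q))" "q \<in> rt ` S - S"
    then show ?thesis using Vedge[of q] by simp
  next
    fix q assume "(a, b) = (P (up q), P q)" "q \<in> S - rt ` S"
    then show ?thesis using Vedge[of q] by (subst closed_segment_commute) simp
  qed
  define T where "T = (\<lambda>f z. \<Sum>(a, b)\<leftarrow>es. contour_integral (linepath a b) (\<lambda>w. f w / (w - z)))"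
  have inner: "T f z = 2 * pi * \<i> * f z"
    if f: "f holomorphic_on U" and p: "p \<in> S" and z: "z \<in> box (P p) (P (rt (up p)))" for f z p
  proof -
    let ?F = "\<lambda>w. f w / (w - z)"
    define h v where "h = (\<lambda>p. contour_integral (linepath (P p) (P (rt p))) ?F)" 
      and "v = (\<lambda>p. contour_integral (linepath (P p) (P (up p))) ?F)"
    have zb: "z \<in> box (grid_point d (fst p) (snd p)) (grid_point d (fst p + 1) (snd p + 1))"
      using z by (simp add: P_def up_def rt_def)
    have cell: "(if q = p then 2 * pi * \<i> * f z else 0) = (h q - h (up q)) - (v q - v (rt q))" 
      and zn: "z \<notin> path_image (rectpath (P q) (P (rt (up q))))" if q: "q \<in> S" for q
    proof -
      have fq: "f holomorphic_on grid_cell d q" using f SU[OF q] holomorphic_on_subset by blast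
      note c = grid_cell_cauchy[OF d(1) fq zb]
      show zn: "z \<notin> path_image (rectpath (P q) (P (rt (up q))))"
        using c(2) by (simp add: P_def up_def rt_def)
      have sub: "path_image (rectpath (P q) (P (rt (up q)))) \<subseteq> U"
        using path_image_rectpath_subset_cbox[of "P q" "P (rt (up q))"] SU[OF q] d
        by (auto simp: grid_cell_def P_def up_def rt_def grid_point_def algebra_simps)
      have "continuous_on (path_image (rectpath (P q) (P (rt (up q))))) ?F"
        by (intro continuous_intros holomorphic_on_imp_continuous_on holomorphic_on_subset[OF f sub]) (use zn in auto)
      from contour_integral_rectpath[OF this]
      have "contour_integral (rectpath (P q) (P (rt (up q)))) ?F = h q + v (rt q) - h (up q) - v q"
        by (simp add: h_def v_def P_def up_def rt_def grid_point_def)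
      then show "(if q = p then 2 * pi * \<i> * f z else 0) = (h q - h (up q)) - (v q - v (rt q))"
        using c(1) by (simp add: P_def up_def rt_def)
    qed
    have "2 * pi * \<i> * f z = (\<Sum>q\<in>S. (if q = p then 2 * pi * \<i> * f z else 0))"
      using p finS by simp
    also have "\<dots> = (\<Sum>q\<in>S. (h q - h (up q)) - (v q - v (rt q)))"
      by (rule sum.cong) (use cell in auto)
    also have "\<dots> = (\<Sum>q\<in>S. h q - h (up q)) - (\<Sum>q\<in>S. v q - v (rt q))"
      by (rule sum_subtractf)
    also have "\<dots> = ((\<Sum>q\<in>S - up ` S. h q) - (\<Sum>q\<in>up ` S - S. h q)) - ((\<Sum>q\<in>S - rt ` S. v q) - (\<Sum>q\<in>rt ` S - S. v q))"
      by (simp only: sum_shift_cancel[OF finS inj(1)] sum_shift_cancel[OF finS inj(2)])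
    finally have A: "2 * pi * \<i> * f z = \<dots>" .
    have zseg: "z \<notin> closed_segment (P q) (P (rt q))" "z \<notin> closed_segment (P q) (P (up q))" for q
    proof -
      have "Im z \<noteq> Im (P q) \<and> Re z \<noteq> Re (P q)" if "z \<in> grid_cell d q"
        using grid_cell_disjoint[OF d(1) zb that] zb
        by (auto simp: P_def in_box_complex_iff)
      then show "z \<notin> closed_segment (P q) (P (rt q))" "z \<notin> closed_segment (P q) (P (up q))"
        using edge(1,2)[of q] closed_segment_same_Im[of "P q" "P (rt q)"] closed_segment_same_Re[of "P q" "P (up q)"]
        by (auto simp: P_def rt_def up_def grid_point_def)
    qed
    have rev: "contour_integral (linepath (P (rt q)) (P q)) ?F = - h q"
      if "q \<in> up ` S - S" for q
      unfolding h_def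
      by (rule contour_integral_reverse_linepath) 
        (intro continuous_intros holomorphic_on_imp_continuous_on holomorphic_on_subset[OF f]; 
         use zseg[of q] Hedge[of q] that in \<open>auto simp: closed_segment_commute\<close>)
    have rev': "contour_integral (linepath (P (up q)) (P q)) ?F = - v q"
      if "q \<in> S - rt ` S" for q
      unfolding v_def
      by (rule contour_integral_reverse_linepath) 
        (intro continuous_intros holomorphic_on_imp_continuous_on holomorphic_on_subset[OF f]; 
         use zseg[of q] Vedge[of q] that in \<open>auto simp: closed_segment_commute\<close>)
    have "T f z = (\<Sum>q\<in>S - up ` S. h q) + (\<Sum>q\<in>up ` S - S. - h q) + (\<Sum>q\<in>rt ` S - S. v q) + (\<Sum>q\<in>S - rt ` S. - v q)"
    proof -
      have "T f z = sum_list (map h h1) + sum_list (map (\<lambda>q. contour_integral (linepath (P (rt q)) (P q)) ?F) h2)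
         + sum_list (map v v1) + sum_list (map (\<lambda>q. contour_integral (linepath (P (up q)) (P q)) ?F) v2)"
        by (simp add: T_def es_def h_def v_def o_def)
      also have "\<dots> = (\<Sum>q\<in>S - up ` S. h q) + (\<Sum>q\<in>up ` S - S. contour_integral (linepath (P (rt q)) (P q)) ?F)
         + (\<Sum>q\<in>rt ` S - S. v q) + (\<Sum>q\<in>S - rt ` S. contour_integral (linepath (P (up q)) (P q)) ?F)"
        using lists by (simp add: sum_list_distinct_conv_sum_set)
      also have "(\<Sum>q\<in>up ` S - S. contour_integral (linepath (P (rt q)) (P q)) ?F) = (\<Sum>q\<in>up ` S - S. - h q)"
        by (rule sum.cong[OF refl rev])
      also have "(\<Sum>q\<in>S - rt ` S. contour_integral (linepath (P (up q)) (P q)) ?F) = (\<Sum>q\<in>S - rt ` S. - v q)"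
        by (rule sum.cong[OF refl rev'])
      finally show ?thesis .
    qed
    then show ?thesis unfolding A by (simp add: sum_negf)
  qed
  have "2 * pi * \<i> * f z = T f z" if f: "f holomorphic_on U" and z: "z \<in> K" for f z
  proof -
    \<comment> \<open>The point \<open>z\<close> may lie on a grid line; approach it from the interior of a cell.\<close>
    obtain p where p: "z \<in> grid_cell d p" using grid_cell_exists[OF d(1)] by blast
    then have pS: "p \<in> S" using z by (auto simp: S_def)
    have "box (P p) (P (rt (up p))) \<noteq> {}"
      using d by (auto simp: box_ne_empty P_def up_def rt_def grid_point_def Basis_complex_def algebra_simps)
    then have "grid_cell d p = closure (box (P p) (P (rt (up p))))"
      by (simp add: grid_cell_def P_def up_def rt_def closure_box)
    then obtain x where x: "\<And>n. x n \<in> box (P p) (P (rt (up p)))" "x \<longlonglongrightarrow> z"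
      using p closure_sequential by blast
    have "isCont (\<lambda>z. contour_integral (linepath a b) (\<lambda>w. f w / (w - z))) z" if "(a, b) \<in> set es" for a b
      by (rule continuous_cauchy_segment)
        (use esU[OF that] z f in \<open>auto intro!: holomorphic_on_imp_continuous_on elim: holomorphic_on_subset\<close>)
    then have "isCont (\<lambda>z. \<Sum>(a, b)\<leftarrow>es'. contour_integral (linepath a b) (\<lambda>w. f w / (w - z))) z"
      if "set es' \<subseteq> set es" for es'
      using that by (induction es') (auto intro!: continuous_intros)
    then have "isCont (T f) z" unfolding T_def by blast
    then have "(\<lambda>n. T f (x n)) \<longlonglongrightarrow> T f z" using x(2) by (rule isCont_tendsto_compose)
    moreover have "isCont f z" 
      using f z U by (meson continuous_on_eq_continuous_at holomorphic_on_imp_continuous_on subsetD)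
    then have "(\<lambda>n. 2 * pi * \<i> * f (x n)) \<longlonglongrightarrow> 2 * pi * \<i> * f z"
      by (intro tendsto_intros isCont_tendsto_compose[OF _ x(2)])
    moreover have "(\<lambda>n. T f (x n)) = (\<lambda>n. 2 * pi * \<i> * f (x n))"
      by (rule ext) (rule inner[OF f pS x(1)])
    ultimately show ?thesis by (metis LIMSEQ_unique)
  qed
  with esU show ?thesis using that unfolding T_def by blast
qed

section \<open>Rational approximation\<close>

text \<open>
  Riemann sums of the integral are linear combinations of Cauchy kernels. They are produced by repeated
  bisection of the segment: the errors on two halves add up to the error allowed for the whole.
\<close>

lemma cauchy_integral_in_closure:
  assumes K: "compact K" "K \<inter> A = {}" and f: "continuous_on (closed_segment a b) f"
    and dis: "closed_segment a b \<inter> K = {}"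
    and w: "\<And>w. w \<in> closed_segment a b \<Longrightarrow> pole_reachable A K w"
  shows "(\<lambda>z. contour_integral (linepath a b) (\<lambda>w. f w / (w - z))) \<in> rational_closure A K"
proof (rule rational_closure_limit)
  fix e :: real assume e: "e > 0"
  define e' where "e' = e / (norm (b - a) + 1)"
  have "norm (b - a) + 1 > 0" using norm_ge_zero[of "b - a"] by linarith
  then have e': "e' > 0" "e' * norm (b - a) \<le> e" using e by (auto simp: e'_def field_simps)
  let ?F = "\<lambda>p. f (fst p) / (fst p - snd p)"
  have cont: "continuous_on (closed_segment a b \<times> K) ?F"
    by (intro continuous_intros continuous_on_compose2[OF f]) (use dis in auto)
  then have "uniformly_continuous_on (closed_segment a b \<times> K) ?F"
    by (rule compact_uniformly_continuous) (intro compact_Times K compact_segment)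
  then obtain d where d: "d > 0" "\<And>p q. p \<in> closed_segment a b \<times> K \<Longrightarrow> q \<in> closed_segment a b \<times> K \<Longrightarrow>
      dist q p < d \<Longrightarrow> dist (?F q) (?F p) < e'"
    unfolding uniformly_continuous_on_def using e'(1) by metis
  have bisect: "\<exists>r\<in>rational_closure A K. \<forall>z\<in>K. 
      norm (contour_integral (linepath x y) (\<lambda>w. f w / (w - z)) - r z) \<le> e' * norm (y - x)"
    if "closed_segment x y \<subseteq> closed_segment a b" "norm (y - x) < 2 ^ n * d" for x y n
    using that
  proof (induction n arbitrary: x y)
    case 0
    have xin: "x \<in> closed_segment a b" using 0 by auto
    define r where "r z = (- f x * (y - x)) * (1 / (z - x))" for z
    have "r \<in> rational_closure A K" unfolding r_def
      by (rule rational_closure_mult[OF rational_closure_const cauchy_kernel_in_closure[OF K w[OF xin]] K])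
    moreover have "norm (contour_integral (linepath x y) (\<lambda>w. f w / (w - z)) - r z) \<le> e' * norm (y - x)"
      if z: "z \<in> K" for z
    proof (rule has_contour_integral_bound_linepath)
      have "(\<lambda>w. f w / (w - z)) contour_integrable_on linepath x y"
        by (intro contour_integrable_continuous_linepath continuous_intros continuous_on_subset[OF f]) 
          (use 0 dis z in auto)
      then have "((\<lambda>w. f w / (w - z) - f x / (x - z)) has_contour_integral
          contour_integral (linepath x y) (\<lambda>w. f w / (w - z)) - (f x / (x - z)) * (y - x)) (linepath x y)"
        by (intro has_contour_integral_diff has_contour_integral_integral has_contour_integral_const_linepath)
      moreover have "(f x / (x - z)) * (y - x) = r z"
      proof -
        have "x \<noteq> z" using xin z dis by auto
        then show ?thesis by (simp add: r_def field_simps)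
      qed
      ultimately show "((\<lambda>w. f w / (w - z) - f x / (x - z)) has_contour_integral
          contour_integral (linepath x y) (\<lambda>w. f w / (w - z)) - r z) (linepath x y)" by simp
      fix u assume u: "u \<in> closed_segment x y"
      have "norm (u - x) \<le> norm (y - x)" using segment_bound1[OF u] .
      then have "dist (u, z) (x, z) < d" using 0 by (simp add: dist_Pair_Pair dist_norm)
      then have "dist (?F (u, z)) (?F (x, z)) < e'"
        by (intro d(2)) (use u xin z 0 in auto)
      then show "norm (f u / (u - z) - f x / (x - z)) \<le> e'" by (simp add: dist_norm)
    qed (use e' in auto)
    ultimately show ?case by blast
  next
    case (Suc n)
    define m where "m = midpoint x y"
    have m: "m \<in> closed_segment x y" by (simp add: m_def)
    have sub: "closed_segment x m \<subseteq> closed_segment x y" "closed_segment m y \<subseteq> closed_segment x y"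
      using m by (auto simp: subset_closed_segment)
    have nm: "norm (m - x) = norm (y - x) / 2" "norm (y - m) = norm (y - x) / 2"
      using dist_midpoint[of x y] by (auto simp: m_def dist_norm norm_minus_commute)
    obtain r where r: "r \<in> rational_closure A K" "\<And>z. z \<in> K \<Longrightarrow>
      norm (contour_integral (linepath x m) (\<lambda>w. f w / (w - z)) - r z) \<le> e' * norm (m - x)"
    proof -
      have "closed_segment x m \<subseteq> closed_segment a b" "norm (m - x) < 2 ^ n * d"
        using sub(1) Suc.prems nm by auto
      from Suc.IH[OF this] show ?thesis using that by blast
    qed
    obtain s where s: "s \<in> rational_closure A K" "\<And>z. z \<in> K \<Longrightarrow>
      norm (contour_integral (linepath m y) (\<lambda>w. f w / (w - z)) - s z) \<le> e' * norm (y - m)"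
    proof -
      have "closed_segment m y \<subseteq> closed_segment a b" "norm (y - m) < 2 ^ n * d"
        using sub(2) Suc.prems nm by auto
      from Suc.IH[OF this] show ?thesis using that by blast
    qed
    show ?case
    proof (rule bexI[OF _ rational_closure_add[OF r(1) s(1)]], rule ballI)
      fix z assume z: "z \<in> K"
      have "continuous_on (closed_segment x y) (\<lambda>w. f w / (w - z))"
        by (intro continuous_intros continuous_on_subset[OF f]) (use Suc.prems dis z in auto)
      then have "contour_integral (linepath x y) (\<lambda>w. f w / (w - z)) =
        contour_integral (linepath x m) (\<lambda>w. f w / (w - z)) + contour_integral (linepath m y) (\<lambda>w. f w / (w - z))"
        using m by (rule contour_integral_split_linepath)
      then show "norm (contour_integral (linepath x y) (\<lambda>w. f w / (w - z)) - (r z + s z)) \<le> e' * norm (y - x)"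
        using norm_diff_triangle_ineq[of "contour_integral (linepath x m) (\<lambda>w. f w / (w - z))"
            "contour_integral (linepath m y) (\<lambda>w. f w / (w - z))" "r z" "s z"] r(2)[OF z] s(2)[OF z] nm by simp
    qed
  qed
  obtain n where "norm (b - a) / d < 2 ^ n" using real_arch_pow[of 2] by auto
  then have "norm (b - a) < 2 ^ n * d" using d(1) by (simp add: field_simps)
  from bisect[OF order_refl this] e'(2)
  show "\<exists>h\<in>rational_closure A K. \<forall>z\<in>K. norm (contour_integral (linepath a b) (\<lambda>w. f w / (w - z)) - h z) \<le> e"
    by (meson order_trans)
qed

lemma compact_neighbourhood:
  fixes K :: "complex set"
  assumes "compact K" "open U" "K \<subseteq> U"
  obtains d where "d > 0" "\<And>d'. 0 < d' \<Longrightarrow> d' \<le> d \<Longrightarrow> (\<Union>x\<in>K. cball x d') \<subseteq> U \<and> compact (\<Union>x\<in>K. cball x d')"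
proof -
  obtain e where e: "e > 0" "\<And>x. x \<in> K \<Longrightarrow> ball x e \<subseteq> U"
    using Heine_Borel_lemma[of K "{U}"] assms by auto
  have "(\<Union>x\<in>K. cball x d') \<subseteq> U" if "d' \<le> e / 2" "d' > 0" for d'
  proof -
    have "cball x d' \<subseteq> ball x e" for x using that e(1) by auto
    then show ?thesis using e(2) by blast
  qed
  moreover have "compact (\<Union>x\<in>K. cball x d')" for d'
  proof -
    have eq: "(\<Union>x\<in>K. cball x d') = {x + y | x y. x \<in> K \<and> y \<in> cball 0 d'}"
    proof (intro equalityI subsetI)
      fix z assume "z \<in> (\<Union>x\<in>K. cball x d')"
      then obtain x where "x \<in> K" "z \<in> cball x d'" by blast
      then show "z \<in> {x + y | x y. x \<in> K \<and> y \<in> cball 0 d'}"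
        by (intro CollectI exI[of _ x] exI[of _ "z - x"]) (auto simp: dist_norm norm_minus_commute)
    next
      fix z assume "z \<in> {x + y | x y. x \<in> K \<and> y \<in> cball 0 d'}"
      then obtain x y where "z = x + y" "x \<in> K" "norm y \<le> d'" by auto
      then show "z \<in> (\<Union>x\<in>K. cball x d')" by (intro UN_I[of x]) (auto simp: dist_norm)
    qed
    show ?thesis unfolding eq by (rule compact_sums[OF assms(1) compact_cball])
  qed
  ultimately show ?thesis using that[of "e/2"] e(1) by simp
qed

text \<open>
  Runge's theorem, with approximation on a neighbourhood of \<open>K\<close> that is fixed before the accuracy. This order matters:
  Cauchy estimates then also control derivatives on \<open>K\<close>. The neighbourhood only has to avoid
  finitely many compact connected sets along which the poles on the edges are moved away.
\<close>

lemma runge_on_neighbourhood: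
  assumes K: "compact K" and A: "closed A" "K \<inter> A = {}" and U: "open U" "K \<subseteq> U" and f: "f holomorphic_on U"
    and good: "\<And>w. w \<notin> K \<Longrightarrow> connected_component_set (- K) w \<inter> A \<noteq> {} \<or> \<not> bounded (connected_component_set (- K) w)"
  obtains d K' where "d > 0" "compact K'" "K' \<inter> A = {}" "K' \<subseteq> U" "\<And>x. x \<in> K \<Longrightarrow> cball x d \<subseteq> K'"
    "f \<in> rational_closure A K'"
proof -
  have "open (U - A)" "K \<subseteq> U - A" using A U by auto
  from compact_neighbourhood[OF K this] obtain d0 where d0: "d0 > 0"
    "\<And>d'. 0 < d' \<Longrightarrow> d' \<le> d0 \<Longrightarrow> (\<Union>x\<in>K. cball x d') \<subseteq> U - A \<and> compact (\<Union>x\<in>K. cball x d')" by blast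
  define K0 where "K0 = (\<Union>x\<in>K. cball x d0)"
  have K0: "compact K0" "K0 \<subseteq> U - A" "K \<subseteq> K0" using d0(2)[of d0] d0(1) by (auto simp: K0_def)
  have "K0 \<subseteq> U" using K0 by auto
  obtain es where es: "\<And>a b. (a, b) \<in> set es \<Longrightarrow> closed_segment a b \<subseteq> U - K0"
    "\<And>f z. f holomorphic_on U \<Longrightarrow> z \<in> K0 \<Longrightarrow>
      2 * pi * \<i> * f z = (\<Sum>(a, b)\<leftarrow>es. contour_integral (linepath a b) (\<lambda>w. f w / (w - z)))"
    using cauchy_formula_compact[OF K0(1) U(1) \<open>K0 \<subseteq> U\<close>] by blast
  obtain R where R: "\<And>z. z \<in> K0 \<Longrightarrow> norm z \<le> R" using compact_imp_bounded[OF K0(1)] bounded_iff by blast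
  have "open (- K)" using compact_imp_closed[OF K] by (rule open_Compl)
  have ex: "\<exists>S. compact S \<and> connected S \<and> S \<inter> K = {} \<and> closed_segment (fst p) (snd p) \<subseteq> S \<and>
      (\<exists>b\<in>S. b \<in> A \<or> (\<forall>z\<in>K0. 2 * norm z < norm b))" if "p \<in> set es" for p
  proof -
    obtain a b where p: "p = (a, b)" by fastforce
    define C where "C = connected_component_set (- K) a"
    have seg: "closed_segment a b \<inter> K = {}" using es(1)[of a b] that p K0 by auto
    then have aK: "a \<notin> K" by auto
    have "\<exists>t\<in>C. t \<in> A \<or> (\<forall>z\<in>K0. 2 * norm z < norm t)"
    proof (cases "C \<inter> A = {}")
      case True
      then have "\<not> bounded C" using good[OF aK] by (simp add: C_def)
      then obtain t where "t \<in> C" "norm t > 2 * R" unfolding bounded_iff by (meson not_le)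
      then show ?thesis using R by (intro bexI[of _ t]) force+
    qed auto
    then obtain t where t: "t \<in> C" "t \<in> A \<or> (\<forall>z\<in>K0. 2 * norm z < norm t)" by blast
    have "open C" "connected C" "a \<in> C" unfolding C_def using \<open>open (- K)\<close> aK
      by (auto intro: open_connected_component)
    then have "path_connected C" by (simp add: connected_open_path_connected)
    then obtain g where g: "path g" "path_image g \<subseteq> C" "pathstart g = a" "pathfinish g = t"
      using \<open>a \<in> C\<close> t(1) unfolding path_connected_def by blast
    have CK: "C \<inter> K = {}" unfolding C_def using connected_component_subset[of "- K" a] by auto
    show ?thesis
    proof (intro exI conjI)
      show "compact (closed_segment a b \<union> path_image g)" using g by (intro compact_Un compact_segment compact_path_image) auto
      show "connected (closed_segment a b \<union> path_image g)"
        by (rule connected_Un) (use g pathstart_in_path_image[of g] in \<open>auto simp: connected_path_image\<close>)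
      show "(closed_segment a b \<union> path_image g) \<inter> K = {}" using seg g CK by auto
      show "\<exists>b\<in>closed_segment a b \<union> path_image g. b \<in> A \<or> (\<forall>z\<in>K0. 2 * norm z < norm b)"
        using g t pathfinish_in_path_image[of g] by auto
    qed (use p in auto)
  qed
  then obtain S where S: "\<And>p. p \<in> set es \<Longrightarrow> compact (S p) \<and> connected (S p) \<and> S p \<inter> K = {} \<and> closed_segment (fst p) (snd p) \<subseteq> S p \<and>
      (\<exists>b\<in>S p. b \<in> A \<or> (\<forall>z\<in>K0. 2 * norm z < norm b))" by metis
  define B where "B = (\<Union>p\<in>set es. S p)"
  have "compact B" unfolding B_def using S by (intro compact_UN) auto
  from open_Compl[OF compact_imp_closed[OF this]] have "open (- B)" .
  moreover have "K \<subseteq> - B" using S unfolding B_def by blast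
  ultimately obtain d1 where d1: "d1 > 0"
    "\<And>d'. 0 < d' \<Longrightarrow> d' \<le> d1 \<Longrightarrow> (\<Union>x\<in>K. cball x d') \<subseteq> - B \<and> compact (\<Union>x\<in>K. cball x d')"
    using compact_neighbourhood[OF K] by blast
  define d where "d = min d0 d1"
  define K' where "K' = (\<Union>x\<in>K. cball x d)"
  have d: "d > 0" "d \<le> d0" "d \<le> d1" using d0 d1 by (auto simp: d_def)
  have K'K0: "K' \<subseteq> K0" unfolding K'_def K0_def using d by (intro UN_mono) auto
  have K': "compact K'" "K' \<inter> A = {}" "K' \<subseteq> U" "K' \<inter> B = {}"
    using d0(2)[of d] d1(2)[of d] d unfolding K'_def by blast+
  have edge: "(\<lambda>z. contour_integral (linepath a b) (\<lambda>w. f w / (w - z))) \<in> rational_closure A K'" if ab: "(a, b) \<in> set es" for a b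
  proof (rule cauchy_integral_in_closure[OF K'(1,2)])
    show "continuous_on (closed_segment a b) f"
      using es(1)[OF ab] by (intro holomorphic_on_imp_continuous_on holomorphic_on_subset[OF f]) auto
    show "closed_segment a b \<inter> K' = {}" using es(1)[OF ab] K'K0 by auto
    fix w assume w: "w \<in> closed_segment a b"
    show "pole_reachable A K' w" unfolding pole_reachable_def
    proof (intro exI[of _ "S (a, b)"] conjI)
      show "S (a, b) \<inter> K' = {}" using K'(4) ab by (auto simp: B_def)
      show "w \<in> S (a, b)" using S[OF ab] w by auto
      show "\<exists>b\<in>S (a, b). b \<in> A \<or> (\<forall>z\<in>K'. 2 * norm z < norm b)" using S[OF ab] K'K0 by blast
    qed (use S[OF ab] in auto)
  qed
  have sumlist: "(\<lambda>z. \<Sum>(a, b)\<leftarrow>es'. contour_integral (linepath a b) (\<lambda>w. f w / (w - z))) \<in> rational_closure A K'"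
    if "set es' \<subseteq> set es" for es'
    using that
  proof (induction es')
    case Nil then show ?case by (simp add: rational_closure_const)
  next
    case (Cons p es')
    obtain a b where p: "p = (a, b)" by fastforce
    have "(\<lambda>z. contour_integral (linepath a b) (\<lambda>w. f w / (w - z)) + 
        (\<Sum>(a, b)\<leftarrow>es'. contour_integral (linepath a b) (\<lambda>w. f w / (w - z)))) \<in> rational_closure A K'"
      by (rule rational_closure_add[OF edge Cons.IH]) (use Cons.prems p in auto)
    then show ?case by (simp add: p)
  qed
  have "f \<in> rational_closure A K'"
  proof (rule rational_closure_cong[OF rational_closure_mult[OF rational_closure_const sumlist[OF order_refl] K'(1,2)]])
    fix z assume "z \<in> K'"
    then have "2 * pi * \<i> * f z = (\<Sum>(a, b)\<leftarrow>es. contour_integral (linepath a b) (\<lambda>w. f w / (w - z)))"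
      using es(2)[OF f] K'K0 by blast
    then show "1 / (2 * pi * \<i>) * (\<Sum>(a, b)\<leftarrow>es. contour_integral (linepath a b) (\<lambda>w. f w / (w - z))) = f z"
      by (metis (no_types, lifting) divide_self_if mult.assoc mult_1 of_real_eq_0_iff pi_neq_zero times_divide_eq_left
          complex_i_not_zero mult_eq_0_iff zero_neq_numeral)
  qed
  then show ?thesis using that[OF d(1) K'(1,2,3)] by (auto simp: K'_def)
qed

text \<open>
  By compactness \<open>f'\<close> is bounded away from \<open>0\<close> on \<open>K\<close>, and \<open>f' - r'\<close> is small there by the
  Cauchy estimate on discs of a fixed radius.
\<close>

lemma locally_univalent_rational_approx:
  assumes K: "compact K" "K \<noteq> {}" and A: "closed A" "K \<inter> A = {}" and U: "open U" "K \<subseteq> U" and f: "f holomorphic_on U"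
    and nz: "\<And>z. z \<in> U \<Longrightarrow> deriv f z \<noteq> 0"
    and good: "\<And>w. w \<notin> K \<Longrightarrow> connected_component_set (- K) w \<inter> A \<noteq> {} \<or> \<not> bounded (connected_component_set (- K) w)"
    and e: "e > 0"
  obtains r where "r \<in> rational_off A" "\<And>z. z \<in> K \<Longrightarrow> norm (f z - r z) < e" "\<And>z. z \<in> K \<Longrightarrow> deriv r z \<noteq> 0"
proof -
  obtain d K' where d: "d > 0" "compact K'" "K' \<inter> A = {}" "K' \<subseteq> U" "\<And>x. x \<in> K \<Longrightarrow> cball x d \<subseteq> K'"
    "f \<in> rational_closure A K'"
    using runge_on_neighbourhood[OF K(1) A U f good] by metis
  have "continuous_on K (\<lambda>z. norm (deriv f z))"
    by (intro continuous_intros holomorphic_on_imp_continuous_on holomorphic_on_subset[OF holomorphic_deriv[OF f U(1)] U(2)])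
  then obtain z0 where z0: "z0 \<in> K" "\<And>z. z \<in> K \<Longrightarrow> norm (deriv f z0) \<le> norm (deriv f z)"
    using continuous_attains_inf[OF K] by blast
  define m where "m = norm (deriv f z0)"
  have m: "m > 0" using nz z0 U by (auto simp: m_def)
  have "min e (m * d / 2) > 0" using e m d(1) by simp
  from rational_closureD[OF d(6) this] obtain r where r: "r \<in> rational_off A"
    "\<And>z. z \<in> K' \<Longrightarrow> norm (f z - r z) < min e (m * d / 2)" by blast
  have KK': "K \<subseteq> K'" using d by force
  have oA: "open (U - A)" using A U by auto
  have rh: "r holomorphic_on U - A" by (rule holomorphic_on_subset[OF rational_off_holomorphic[OF r(1)]]) auto
  have fh: "f holomorphic_on U - A" using f holomorphic_on_subset by blast
  have "deriv r z \<noteq> 0" if z: "z \<in> K" for z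
  proof -
    have sub: "cball z d \<subseteq> U - A" using d(5)[OF z] d(3,4) by blast
    have "norm ((deriv ^^ 1) (\<lambda>w. f w - r w) z) \<le> fact 1 * (m * d / 2) / d ^ 1"
    proof (rule Cauchy_inequality)
      show "(\<lambda>w. f w - r w) holomorphic_on ball z d"
        by (intro holomorphic_intros holomorphic_on_subset[OF fh] holomorphic_on_subset[OF rh]) (use sub ball_subset_cball in blast)+
      show "continuous_on (cball z d) (\<lambda>w. f w - r w)"
        by (intro continuous_intros holomorphic_on_imp_continuous_on holomorphic_on_subset[OF fh] holomorphic_on_subset[OF rh] sub)
      fix x assume "norm (z - x) = d"
      then have "x \<in> K'" using d(5)[OF z] by (auto simp: dist_norm)
      then show "norm (f x - r x) \<le> m * d / 2" using r(2)[of x] by simp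
    qed (use d in auto)
    then have "norm (deriv (\<lambda>w. f w - r w) z) \<le> m / 2" using d(1) by simp
    moreover have "deriv (\<lambda>w. f w - r w) z = deriv f z - deriv r z"
    proof (rule deriv_diff)
      have "z \<in> U - A" using sub d(1) centre_in_cball[of z d] by (meson less_imp_le subsetD)
      then show "f field_differentiable at z" "r field_differentiable at z"
        using fh rh oA holomorphic_on_imp_differentiable_at by blast+
    qed
    moreover have "m \<le> norm (deriv f z)" using z0 z by (simp add: m_def)
    ultimately show ?thesis using m by auto
  qed
  then show ?thesis using that[OF r(1)] r(2) KK' by (meson min_less_iff_conj subsetD)
qed

lemma complex_poly_split_roots:
  fixes p :: "complex poly"
  assumes "p \<noteq> 0"
  shows "\<exists>cs p1. p1 \<noteq> 0 \<and> set cs \<inter> A = {} \<and> (\<forall>c\<in>set cs. poly p c = 0) \<and> (\<forall>z. poly p1 z = 0 \<longrightarrow> z \<in> A) \<and>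
    (\<forall>z. poly p z = (\<Prod>c\<leftarrow>cs. z - c) * poly p1 z)"
  using assms
proof (induction "degree p" arbitrary: p rule: less_induct)
  case less
  show ?case
  proof (cases "\<forall>z. poly p z = 0 \<longrightarrow> z \<in> A")
    case True
    then show ?thesis using less.prems by (intro exI[of _ "[]"] exI[of _ p]) auto
  next
    case False
    then obtain c where c: "poly p c = 0" "c \<notin> A" by blast
    then obtain q where q: "p = [:- c, 1:] * q" by (metis dvdE poly_eq_0_iff_dvd)
    then have "q \<noteq> 0" using less.prems by auto
    moreover have "degree p = 1 + degree q"
      unfolding q by (subst degree_mult_eq) (use \<open>q \<noteq> 0\<close> in auto)
    ultimately have "q \<noteq> 0" "degree q < degree p" by auto
    from less.hyps[OF this(2,1)] obtain cs p1 where
      1: "p1 \<noteq> 0" "set cs \<inter> A = {}" "\<And>c. c \<in> set cs \<Longrightarrow> poly q c = 0" "\<And>z. poly p1 z = 0 \<Longrightarrow> z \<in> A"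
      "\<And>z. poly q z = (\<Prod>c\<leftarrow>cs. z - c) * poly p1 z" by blast
    show ?thesis
    proof (intro exI[of _ "c # cs"] exI[of _ p1] conjI allI impI ballI)
      show "poly p z = (\<Prod>c\<leftarrow>c # cs. z - c) * poly p1 z" for z
        unfolding q poly_mult 1(5) by simp
      show "poly p x = 0" if "x \<in> set (c # cs)" for x
        using that c(1) 1(3) unfolding q poly_mult by auto
    qed (use 1 c in auto)
  qed
qed

text \<open>
  A zero of the numerator of \<open>r'\<close> is listed in \<open>cs\<close> if it lies off \<open>A\<close>, that is, if it has to be removed. The
  other zeros join the poles in the finite exceptional set \<open>A0\<close>; they do no harm there.
\<close>

lemma rational_derivative_factorization:
  assumes r: "r \<in> rational_off A" and A: "closed A" and K: "K \<noteq> {}" "K \<inter> A = {}" and nz: "\<And>z. z \<in> K \<Longrightarrow> deriv r z \<noteq> 0"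
  obtains A0 G N cs where "finite A0" "A0 \<subseteq> A" "set cs \<inter> A = {}" "set cs \<inter> K = {}"
    "N holomorphic_on - A0" "\<And>z. z \<notin> A0 \<Longrightarrow> N z \<noteq> 0"
    "\<And>z. z \<notin> A0 \<Longrightarrow> (G has_field_derivative (\<Prod>c\<leftarrow>cs. z - c) * N z) (at z)"
    "\<And>z. z \<notin> A \<Longrightarrow> G z = r z"
proof -
  from r obtain p q where pq: "q \<noteq> 0" "\<And>z. poly q z = 0 \<Longrightarrow> z \<in> A" "\<And>z. z \<notin> A \<Longrightarrow> r z = poly p z / poly q z"
    unfolding rational_off_def by blast
  define G where "G z = poly p z / poly q z" for z
  define n where "n = pderiv p * q - p * pderiv q"
  have G: "(G has_field_derivative poly n z / (poly q z)\<^sup>2) (at z)" if "poly q z \<noteq> 0" for z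
    unfolding G_def using that 
    by (auto intro!: derivative_eq_intros poly_DERIV simp: n_def power2_eq_square algebra_simps)
  have dr: "deriv r z = poly n z / (poly q z)\<^sup>2" if "z \<notin> A" for z
  proof (rule DERIV_imp_deriv, rule has_field_derivative_transform_within_open[OF G])
    show "poly q z \<noteq> 0" using pq(2) that by blast
    show "open (- A)" using A by auto
  qed (use that pq(3) in \<open>auto simp: G_def\<close>)
  have nnz: "poly n z \<noteq> 0" if "z \<in> K" for z
  proof -
    have "z \<notin> A" using that K(2) by blast
    then show ?thesis using nz[OF that] dr[of z] by auto
  qed
  then have "n \<noteq> 0" using K(1) by (metis all_not_in_conv poly_0)
  from complex_poly_split_roots[OF this, of A] obtain cs n1 where
    1: "n1 \<noteq> 0" "set cs \<inter> A = {}" "\<And>c. c \<in> set cs \<Longrightarrow> poly n c = 0" "\<And>z. poly n1 z = 0 \<Longrightarrow> z \<in> A"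
      "\<And>z. poly n z = (\<Prod>c\<leftarrow>cs. z - c) * poly n1 z" by blast
  define A0 where "A0 = {z. poly q z = 0} \<union> {z. poly n1 z = 0}"
  define N where "N z = poly n1 z / (poly q z)\<^sup>2" for z
  show ?thesis
  proof (rule that[of A0 cs N G])
    show "finite A0" unfolding A0_def using pq(1) 1(1) by (simp add: poly_roots_finite)
    show "A0 \<subseteq> A" using pq 1 by (auto simp: A0_def)
    show "set cs \<inter> K = {}" using 1(3) nnz by auto
    show "N holomorphic_on - A0" unfolding N_def by (intro holomorphic_intros) (auto simp: A0_def)
    show "N z \<noteq> 0" if "z \<notin> A0" for z using that by (auto simp: A0_def N_def)
    show "(G has_field_derivative (\<Prod>c\<leftarrow>cs. z - c) * N z) (at z)" if "z \<notin> A0" for z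
      using G[of z] that by (simp add: A0_def N_def 1(5))
    show "G z = r z" if "z \<notin> A" for z using pq(3)[OF that] by (simp add: G_def)
  qed (use 1 in auto)
qed

section \<open>Correcting periods\<close>

text \<open>
  The contraction principle for the supremum norm on families of complex numbers indexed by \<open>I\<close>. In the application
  the size of \<open>I\<close> varies, so it is not encoded in a type and the norm is spelled out coordinatewise.
\<close>

lemma coordinatewise_contraction_fixpoint:
  fixes G :: "('i \<Rightarrow> complex) \<Rightarrow> 'i \<Rightarrow> complex"
  assumes rho: "\<rho> \<ge> 0"
    and contr: "\<And>s t \<delta> i. \<lbrakk>\<And>i. i \<in> I \<Longrightarrow> norm (s i) \<le> \<rho>; \<And>i. i \<in> I \<Longrightarrow> norm (t i) \<le> \<rho>;
        \<And>i. i \<in> I \<Longrightarrow> norm (s i - t i) \<le> \<delta>; i \<in> I\<rbrakk> \<Longrightarrow> norm (G s i - G t i) \<le> \<delta> / 2"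
    and start: "\<And>i. i \<in> I \<Longrightarrow> norm (G (\<lambda>_. 0) i) \<le> \<rho> / 2"
  obtains t where "\<And>i. i \<in> I \<Longrightarrow> norm (t i) \<le> \<rho>" "\<And>i. i \<in> I \<Longrightarrow> G t i = t i"
proof -
  define x where "x n = (G ^^ n) (\<lambda>_. 0)" for n
  have x0: "x 0 = (\<lambda>_. 0)" and xS: "x (Suc n) = G (x n)" for n by (simp_all add: x_def)
  have inv: "\<forall>i\<in>I. norm (x n i) \<le> \<rho> - \<rho> / 2 ^ n \<and> norm (x (Suc n) i - x n i) \<le> \<rho> / 2 ^ Suc n" for n
  proof (induction n)
    case 0 then show ?case using start by (simp add: x0 xS)
  next
    case (Suc n)
    have le: "norm (x (Suc n) i) \<le> \<rho> - \<rho> / 2 ^ Suc n" if "i \<in> I" for i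
    proof -
      have "norm (x (Suc n) i) \<le> norm (x n i) + norm (x (Suc n) i - x n i)"
        by (metis norm_triangle_sub)
      also have "\<dots> \<le> (\<rho> - \<rho> / 2 ^ n) + \<rho> / 2 ^ Suc n" using Suc that by (intro add_mono) auto
      finally show ?thesis by (simp add: field_simps)
    qed
    have "norm (x (Suc (Suc n)) i - x (Suc n) i) \<le> (\<rho> / 2 ^ Suc n) / 2" if "i \<in> I" for i
      unfolding xS[of "Suc n"] xS[of n]
    proof (rule contr[OF _ _ _ that])
      show "norm (G (x n) i) \<le> \<rho>" if "i \<in> I" for i
        using le[OF that] rho by (simp add: xS) (smt (verit) divide_nonneg_pos zero_less_power)
      show "norm (x n i) \<le> \<rho>" if "i \<in> I" for i
        using Suc that rho by (smt (verit) divide_nonneg_pos zero_less_power)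
      show "norm (G (x n) i - x n i) \<le> \<rho> / 2 ^ Suc n" if "i \<in> I" for i
        using Suc that by (simp add: xS)
    qed
    with le show ?case by simp
  qed
  have diff: "norm (x (n + k) i - x n i) \<le> \<rho> / 2 ^ n - \<rho> / 2 ^ (n + k)" if "i \<in> I" for i n k
  proof (induction k)
    case (Suc k)
    have "norm (x (Suc (n + k)) i - x n i) \<le> norm (x (Suc (n + k)) i - x (n + k) i) + norm (x (n + k) i - x n i)"
      using norm_triangle_ineq[of "x (Suc (n + k)) i - x (n + k) i" "x (n + k) i - x n i"] by simp
    also have "\<dots> \<le> \<rho> / 2 ^ Suc (n + k) + (\<rho> / 2 ^ n - \<rho> / 2 ^ (n + k))"
      using inv[of "n + k"] that Suc by (intro add_mono) auto
    finally show ?case by (simp add: field_simps)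
  qed simp
  have conv: "convergent (\<lambda>n. x n i)" if i: "i \<in> I" for i
  proof (rule Cauchy_convergent, rule CauchyI')
    fix e :: real assume "e > 0"
    have "(\<lambda>n. \<rho> * (1/2) ^ n) \<longlonglongrightarrow> \<rho> * 0" by (intro tendsto_intros LIMSEQ_realpow_zero) auto
    then obtain N where N: "\<rho> * (1/2) ^ N < e"
      using \<open>e > 0\<close> by (metis (no_types, lifting) eventually_sequentially mult_zero_right order_refl order_tendstoD(2))
    have "dist (x m i) (x n i) < e" if mn: "m \<ge> N" "n > m" for m n
    proof -
      have "norm (x (m + (n - m)) i - x m i) \<le> \<rho> / 2 ^ m - \<rho> / 2 ^ (m + (n - m))"
        by (rule diff[OF i])
      also have "\<dots> \<le> \<rho> / 2 ^ m" using rho by simp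
      also have "\<dots> \<le> \<rho> / 2 ^ N" using rho mn by (intro divide_left_mono) auto
      also have "\<dots> < e" using N by (simp add: power_divide)
      finally show ?thesis using mn by (simp add: dist_norm norm_minus_commute)
    qed
    then show "\<exists>M. \<forall>m\<ge>M. \<forall>n>m. dist (x m i) (x n i) < e" by blast
  qed
  define t where "t i = lim (\<lambda>n. x n i)" for i
  have lim: "(\<lambda>n. x n i) \<longlonglongrightarrow> t i" if "i \<in> I" for i
    using conv[OF that] by (simp add: t_def convergent_LIMSEQ_iff)
  have xle: "norm (x n i) \<le> \<rho>" if "i \<in> I" for n i
    using inv[of n] that rho by (smt (verit) divide_nonneg_pos zero_less_power)
  have tle: "norm (t i) \<le> \<rho>" if "i \<in> I" for i
    using Lim_norm_ubound[OF _ lim[OF that]] xle[OF that] by (simp add: always_eventually)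
  have tx: "norm (t i - x n i) \<le> \<rho> / 2 ^ n" if i: "i \<in> I" for i n
  proof (rule Lim_norm_ubound)
    show "(\<lambda>m. x m i - x n i) \<longlonglongrightarrow> t i - x n i" by (intro tendsto_intros lim i)
    have "norm (x m i - x n i) \<le> \<rho> / 2 ^ n" if "m \<ge> n" for m
    proof -
      have "norm (x (n + (m - n)) i - x n i) \<le> \<rho> / 2 ^ n - \<rho> / 2 ^ (n + (m - n))" by (rule diff[OF i])
      also have "\<dots> \<le> \<rho> / 2 ^ n" using rho by simp
      finally show ?thesis using that by simp
    qed
    then show "\<forall>\<^sub>F m in sequentially. norm (x m i - x n i) \<le> \<rho> / 2 ^ n"
      by (auto simp: eventually_sequentially)
  qed simp
  have "G t i = t i" if i: "i \<in> I" for i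
  proof -
    have b: "norm (G t i - x (Suc n) i) \<le> \<rho> * (1/2) ^ n" for n
    proof -
      have "norm (G t i - G (x n) i) \<le> (\<rho> / 2 ^ n) / 2"
        by (rule contr[OF tle xle tx i])
      also have "\<dots> \<le> \<rho> * (1/2) ^ n" using rho by (simp add: power_divide divide_left_mono)
      finally show ?thesis by (simp add: xS)
    qed
    have "(\<lambda>n. G t i - x (Suc n) i) \<longlonglongrightarrow> 0"
    proof (rule Lim_null_comparison)
      show "\<forall>\<^sub>F n in sequentially. norm (G t i - x (Suc n) i) \<le> \<rho> * (1/2) ^ n" using b by simp
      have "(\<lambda>n. \<rho> * (1/2) ^ n) \<longlonglongrightarrow> \<rho> * 0" by (intro tendsto_intros LIMSEQ_realpow_zero) auto
      then show "(\<lambda>n. \<rho> * (1/2) ^ n) \<longlonglongrightarrow> 0" by simp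
    qed
    moreover have "(\<lambda>n. G t i - x (Suc n) i) \<longlonglongrightarrow> G t i - t i"
      by (intro tendsto_intros LIMSEQ_Suc lim i)
    ultimately show ?thesis using LIMSEQ_unique by fastforce
  qed
  with tle that show ?thesis by blast
qed

text \<open>
  The derivative of \<open>m * exp a - a\<close> in \<open>a\<close> is \<open>m * exp a - 1\<close>, which is small for \<open>m\<close> near \<open>1\<close> and \<open>a\<close> near
  \<open>0\<close>; so that function is nearly constant.
\<close>

lemma perturbed_exp_near_identity:
  fixes \<kappa> :: real
  assumes "\<kappa> > 0"
  obtains \<eta> where "\<eta> > 0"
    "\<And>m a. norm (m - 1) \<le> \<eta> \<Longrightarrow> norm a \<le> \<eta> \<Longrightarrow> norm (m * exp a - 1 :: complex) \<le> \<kappa>"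
    "\<And>m a b. norm (m - 1) \<le> \<eta> \<Longrightarrow> norm a \<le> \<eta> \<Longrightarrow> norm b \<le> \<eta> \<Longrightarrow> 
       norm (m * (exp a - exp b) - (a - b) :: complex) \<le> \<kappa> * norm (a - b)"
proof -
  have "isCont (\<lambda>p :: complex \<times> complex. fst p * exp (snd p)) (1, 0)"
    by (intro continuous_intros)
  from this[unfolded continuous_at_eps_delta, rule_format, OF assms] obtain d where d: "d > 0"
    "\<And>p :: complex \<times> complex. dist p (1, 0) < d \<Longrightarrow> dist (fst p * exp (snd p)) 1 < \<kappa>"
    by auto
  have 1: "norm (m * exp a - 1) \<le> \<kappa>" if "norm (m - 1) \<le> d/3" "norm a \<le> d/3" for m a :: complex
  proof -
    have "dist (m, a) (1, 0) \<le> norm (m - 1) + norm a"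
      using norm_Pair_le[of "m - 1" a] by (simp add: dist_norm)
    with d(2)[of "(m, a)"] d(1) that show ?thesis by (simp add: dist_norm)
  qed
  have 2: "norm (m * (exp a - exp b) - (a - b)) \<le> \<kappa> * norm (a - b)"
    if "norm (m - 1) \<le> d/3" "norm a \<le> d/3" "norm b \<le> d/3" for m a b :: complex
  proof -
    have "norm ((m * exp a - a) - (m * exp b - b)) \<le> \<kappa> * norm (a - b)"
    proof (rule field_differentiable_bound[where S = "cball 0 (d/3)"])
      show "((\<lambda>a. m * exp a - a) has_field_derivative (m * exp z - 1)) (at z within cball 0 (d/3))" for z
        by (auto intro!: derivative_eq_intros)
    qed (use 1 that in auto)
    then show ?thesis by (simp add: algebra_simps)
  qed
  show ?thesis by (rule that[of "d/3"]) (use d 1 2 in auto)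
qed

text \<open>
  Normalised so that the value is the sum of the residues inside the circle.
\<close>

definition circle_mean :: "complex \<Rightarrow> real \<Rightarrow> (complex \<Rightarrow> complex) \<Rightarrow> complex" where
  "circle_mean c r \<phi> = contour_integral (circlepath c r) \<phi> / (2 * pi * \<i>)"

lemma circle_mean_lincomb:
  assumes "continuous_on (sphere c r) \<phi>" "continuous_on (sphere c r) \<psi>" "r > 0"
  shows "circle_mean c r (\<lambda>z. \<phi> z + \<psi> z) = circle_mean c r \<phi> + circle_mean c r \<psi>"
    and "circle_mean c r (\<lambda>z. \<phi> z - \<psi> z) = circle_mean c r \<phi> - circle_mean c r \<psi>"
    and "circle_mean c r (\<lambda>z. k * \<phi> z) = k * circle_mean c r \<phi>"
  using assms by (simp_all add: circle_mean_def contour_integral_add contour_integral_diff contour_integral_lmul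
      contour_integrable_continuous_circlepath add_divide_distrib diff_divide_distrib)

lemma circle_mean_bound:
  assumes "continuous_on (sphere c r) \<phi>" "r > 0" "\<And>z. z \<in> sphere c r \<Longrightarrow> norm (\<phi> z) \<le> B"
  shows "norm (circle_mean c r \<phi>) \<le> r * B"
proof -
  have "c + of_real r \<in> sphere c r" using assms(2) by (simp add: dist_norm)
  then have "0 \<le> B" using assms(3) norm_ge_zero order_trans by blast
  have "(\<phi> has_contour_integral contour_integral (circlepath c r) \<phi>) (circlepath c r)"
    using assms by (intro has_contour_integral_integral contour_integrable_continuous_circlepath) auto
  then have "norm (contour_integral (circlepath c r) \<phi>) \<le> B * (2 * pi * r)"
    by (rule has_contour_integral_bound_circlepath)
      (use assms \<open>0 \<le> B\<close> in \<open>auto simp: dist_norm norm_minus_commute\<close>)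
  then show ?thesis
    by (simp add: circle_mean_def norm_divide norm_mult divide_simps algebra_simps)
qed

lemma circle_mean_sum:
  assumes "finite I" "\<And>i. i \<in> I \<Longrightarrow> continuous_on (sphere c r) (\<phi> i)" "r > 0"
  shows "circle_mean c r (\<lambda>z. \<Sum>i\<in>I. k i * \<phi> i z) = (\<Sum>i\<in>I. k i * circle_mean c r (\<phi> i))"
  using assms
proof (induction I rule: finite_induct)
  case empty
  then show ?case by (simp add: circle_mean_def)
next
  case (insert j I)
  have "circle_mean c r (\<lambda>z. k j * \<phi> j z + (\<Sum>i\<in>I. k i * \<phi> i z)) =
    circle_mean c r (\<lambda>z. k j * \<phi> j z) + circle_mean c r (\<lambda>z. \<Sum>i\<in>I. k i * \<phi> i z)"
    by (rule circle_mean_lincomb) (use insert in \<open>auto intro!: continuous_intros\<close>)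
  also have "circle_mean c r (\<lambda>z. k j * \<phi> j z) = k j * circle_mean c r (\<phi> j)"
    by (rule circle_mean_lincomb(3)[OF _ continuous_on_const]) (use insert in auto)
  finally show ?case using insert by simp
qed

text \<open>
  Let \<open>\<lambda>\<^sub>j\<close> be the mean over circle \<open>j\<close>. Since \<open>\<lambda>\<^sub>j (P u\<^sub>i)\<close> is the identity matrix, the map
  \<open>t \<mapsto> t - \<lambda> (P M exp (\<Sum> t\<^sub>i u\<^sub>i))\<close> has derivative close to \<open>0\<close> near the origin if \<open>M\<close> is close to \<open>1\<close>, and it moves the
  origin only a little because \<open>\<lambda>\<^sub>j P = 0\<close>. Its fixed point is the required \<open>t\<close>.
  The constants depend on \<open>M\<close> only through its distance from \<open>1\<close>, so \<open>\<delta>\<close> can be chosen before \<open>M\<close>.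
\<close>

lemma period_correction:
  fixes c :: "'i \<Rightarrow> complex" and r :: "'i \<Rightarrow> real"
  assumes I: "finite I" and K: "compact K"
    and r: "\<And>i. i \<in> I \<Longrightarrow> r i > 0" "\<And>i. i \<in> I \<Longrightarrow> sphere (c i) (r i) \<subseteq> K"
    and P: "continuous_on K P" "\<And>j. j \<in> I \<Longrightarrow> circle_mean (c j) (r j) P = 0"
    and u: "\<And>i. i \<in> I \<Longrightarrow> continuous_on K (u i)"
    and dual: "\<And>i j. i \<in> I \<Longrightarrow> j \<in> I \<Longrightarrow> circle_mean (c j) (r j) (\<lambda>z. P z * u i z) = (if i = j then 1 else 0)"
    and "\<epsilon> > 0"
  shows "\<exists>\<delta>>0. \<forall>M. continuous_on K M \<longrightarrow> (\<forall>z\<in>K. norm (M z - 1) \<le> \<delta>) \<longrightarrow>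
      (\<exists>t. (\<forall>z\<in>K. norm (M z * exp (\<Sum>i\<in>I. t i * u i z) - 1) \<le> \<epsilon>) \<and>
           (\<forall>j\<in>I. circle_mean (c j) (r j) (\<lambda>z. P z * (M z * exp (\<Sum>i\<in>I. t i * u i z))) = 0))"
proof -
  obtain B where B: "B \<ge> 1" "\<And>z. z \<in> K \<Longrightarrow> norm (P z) \<le> B" "\<And>i z. i \<in> I \<Longrightarrow> z \<in> K \<Longrightarrow> norm (u i z) \<le> B"
    "\<And>i. i \<in> I \<Longrightarrow> r i \<le> B"
  proof -
    have "\<exists>B. \<forall>z\<in>K. norm (g z) \<le> B" if "continuous_on K g" for g :: "complex \<Rightarrow> complex"
      using compact_imp_bounded[OF compact_continuous_image[OF that K]] by (auto simp: bounded_iff)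
    then obtain b where b: "\<And>g z. continuous_on K g \<Longrightarrow> z \<in> K \<Longrightarrow> norm (g z :: complex) \<le> b g" by metis
    define B where "B = 1 + \<bar>b P\<bar> + (\<Sum>i\<in>I. \<bar>b (u i)\<bar>) + (\<Sum>i\<in>I. \<bar>r i\<bar>)"
    have s: "0 \<le> (\<Sum>i\<in>I. \<bar>b (u i)\<bar>)" "0 \<le> (\<Sum>i\<in>I. \<bar>r i\<bar>)" by (auto intro: sum_nonneg)
    have m: "\<bar>b (u i)\<bar> \<le> (\<Sum>i\<in>I. \<bar>b (u i)\<bar>)" "\<bar>r i\<bar> \<le> (\<Sum>i\<in>I. \<bar>r i\<bar>)" if "i \<in> I" for i
      using that I by (auto intro: member_le_sum)
    show ?thesis
    proof (rule that[of B])
      show "B \<ge> 1" using s by (simp add: B_def)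
      show "norm (P z) \<le> B" if "z \<in> K" for z using b[OF P(1) that] s unfolding B_def by linarith
      show "norm (u i z) \<le> B" if "i \<in> I" "z \<in> K" for i z using b[OF u[OF that(1)] that(2)] m(1)[OF that(1)] s unfolding B_def by linarith
      show "r i \<le> B" if "i \<in> I" for i using m(2)[OF that] s unfolding B_def by linarith
    qed
  qed
  define n where "n = real (card I) + 1"
  have n: "n \<ge> 1" by (simp add: n_def)
  \<comment> \<open>The choice makes the Lipschitz bound \<open>B * (B * (\<kappa> * (n * B * d)))\<close> at most \<open>d / 2\<close>.\<close>
  define \<kappa> where "\<kappa> = min \<epsilon> (1 / (2 * n * B ^ 3))"
  have kap: "\<kappa> > 0" "\<kappa> \<le> \<epsilon>" "\<kappa> \<le> 1 / (2 * n * B ^ 3)" using B(1) n \<open>\<epsilon> > 0\<close> by (auto simp: \<kappa>_def)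
  obtain \<eta> where \<eta>: "\<eta> > 0"
    "\<And>m a. norm (m - 1) \<le> \<eta> \<Longrightarrow> norm a \<le> \<eta> \<Longrightarrow> norm (m * exp a - 1 :: complex) \<le> \<kappa>"
    "\<And>m a b. norm (m - 1) \<le> \<eta> \<Longrightarrow> norm a \<le> \<eta> \<Longrightarrow> norm b \<le> \<eta> \<Longrightarrow> 
       norm (m * (exp a - exp b) - (a - b) :: complex) \<le> \<kappa> * norm (a - b)"
    using perturbed_exp_near_identity[OF kap(1)] by blast
  define \<rho> where "\<rho> = \<eta> / (n * B)"
  have rho: "\<rho> > 0" "n * B * \<rho> = \<eta>" using \<eta> n B by (auto simp: \<rho>_def)
  define \<delta> where "\<delta> = min \<eta> (\<rho> / (2 * B\<^sup>2))"
  have del: "\<delta> > 0" "\<delta> \<le> \<eta>" "\<delta> \<le> \<rho> / (2 * B\<^sup>2)" using \<eta> rho B by (auto simp: \<delta>_def)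
  define T where "T t z = (\<Sum>i\<in>I. t i * u i z)" for t z
  have contT: "continuous_on K (T t)" for t unfolding T_def by (intro continuous_intros u)
  have T_diff: "norm (T s z - T t z) \<le> n * B * d" 
    if z: "z \<in> K" and st: "\<And>i. i \<in> I \<Longrightarrow> norm (s i - t i) \<le> d" and "d \<ge> 0" for s t z d
  proof -
    have "norm (T s z - T t z) = norm (\<Sum>i\<in>I. (s i - t i) * u i z)"
      by (simp add: T_def sum_subtractf left_diff_distrib)
    also have "\<dots> \<le> (\<Sum>i\<in>I. d * B)"
      by (rule sum_norm_le) (use st B z \<open>d \<ge> 0\<close> in \<open>auto simp: norm_mult intro!: mult_mono\<close>)
    also have "\<dots> \<le> n * B * d" using B \<open>d \<ge> 0\<close> by (simp add: n_def algebra_simps)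
    finally show ?thesis .
  qed
  have T_small: "norm (T t z) \<le> \<eta>" if "z \<in> K" "\<And>i. i \<in> I \<Longrightarrow> norm (t i) \<le> \<rho>" for t z
    using T_diff[OF that(1), of t "\<lambda>_. 0" \<rho>] that rho by (simp add: T_def)
  have main: "\<exists>t. (\<forall>z\<in>K. norm (M z * exp (T t z) - 1) \<le> \<epsilon>) \<and>
          (\<forall>j\<in>I. circle_mean (c j) (r j) (\<lambda>z. P z * (M z * exp (T t z))) = 0)"
    if M: "continuous_on K M" "\<And>z. z \<in> K \<Longrightarrow> norm (M z - 1) \<le> \<delta>" for M
  proof -
    have M2: "norm (M z - 1) \<le> \<eta>" if "z \<in> K" for z using M(2)[OF that] del by simp
    define G where "G t j = t j - circle_mean (c j) (r j) (\<lambda>z. P z * (M z * exp (T t z)))" for t j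
    have con: "continuous_on (sphere (c j) (r j)) g" if "continuous_on K g" "j \<in> I" for g j
      using continuous_on_subset[OF that(1) r(2)[OF that(2)]] .
    obtain t where t: "\<And>i. i \<in> I \<Longrightarrow> norm (t i) \<le> \<rho>" "\<And>i. i \<in> I \<Longrightarrow> G t i = t i"
    proof (rule coordinatewise_contraction_fixpoint[of \<rho> I G])
      show "\<rho> \<ge> 0" using rho by simp
    next
      fix j assume j: "j \<in> I"
      have "circle_mean (c j) (r j) (\<lambda>z. P z * M z) = 
          circle_mean (c j) (r j) (\<lambda>z. P z * M z) - circle_mean (c j) (r j) P" using P(2)[OF j] by simp
      also have "\<dots> = circle_mean (c j) (r j) (\<lambda>z. P z * M z - P z)"
        by (rule circle_mean_lincomb(2)[symmetric]) (intro continuous_intros con P M j r)+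
      also have "norm \<dots> \<le> r j * (B * \<delta>)"
      proof (rule circle_mean_bound)
        show "continuous_on (sphere (c j) (r j)) (\<lambda>z. P z * M z - P z)"
          by (intro continuous_intros con P M j)
        fix z assume "z \<in> sphere (c j) (r j)"
        then have z: "z \<in> K" using r(2)[OF j] by blast
        have "norm (P z * (M z - 1)) \<le> B * \<delta>"
          unfolding norm_mult by (intro mult_mono) (use B z M in auto)
        then show "norm (P z * M z - P z) \<le> B * \<delta>" by (simp add: algebra_simps)
      qed (use r j in auto)
      also have "\<dots> \<le> B * (B * (\<rho> / (2 * B\<^sup>2)))"
        using B r(1)[OF j] j del by (intro mult_mono) auto
      also have "\<dots> = \<rho> / 2" using B by (simp add: power2_eq_square)
      finally show "norm (G (\<lambda>_. 0) j) \<le> \<rho> / 2" by (simp add: G_def T_def)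
    next
      fix s t :: "'i \<Rightarrow> complex" and d j
      assume s: "\<And>i. i \<in> I \<Longrightarrow> norm (s i) \<le> \<rho>" and t: "\<And>i. i \<in> I \<Longrightarrow> norm (t i) \<le> \<rho>"
        and st: "\<And>i. i \<in> I \<Longrightarrow> norm (s i - t i) \<le> d" and j: "j \<in> I"
      have d0: "d \<ge> 0" using st[OF j] norm_ge_zero order_trans by blast
      define D where "D z = P z * (M z * (exp (T s z) - exp (T t z)) - (T s z - T t z))" for z
      have contD: "continuous_on K D" unfolding D_def by (intro continuous_intros P M contT)
      let ?c = "circle_mean (c j) (r j)"
      have lin: "?c (\<lambda>z. P z * T x z) = x j" for x
      proof -
        have "?c (\<lambda>z. P z * T x z) = ?c (\<lambda>z. \<Sum>i\<in>I. x i * (P z * u i z))"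
          by (simp add: T_def sum_distrib_left mult.left_commute)
        also have "\<dots> = (\<Sum>i\<in>I. x i * ?c (\<lambda>z. P z * u i z))"
          by (rule circle_mean_sum[OF I]) (intro continuous_intros con P u j r | assumption)+
        also have "\<dots> = (\<Sum>i\<in>I. if i = j then x i else 0)" using dual[OF _ j] by (intro sum.cong) auto
        finally show ?thesis using I j by simp
      qed
      have D_eq: "D = (\<lambda>z. (P z * (M z * exp (T s z)) - P z * (M z * exp (T t z))) - (P z * T s z - P z * T t z))"
        by (rule ext) (simp add: D_def algebra_simps)
      have "?c D = ?c (\<lambda>z. (P z * (M z * exp (T s z)) - P z * (M z * exp (T t z)))) - ?c (\<lambda>z. (P z * T s z - P z * T t z))"
        unfolding D_eq by (rule circle_mean_lincomb(2)) (intro continuous_intros con P M j r contT)+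
      also have "?c (\<lambda>z. (P z * (M z * exp (T s z)) - P z * (M z * exp (T t z)))) = ?c (\<lambda>z. P z * (M z * exp (T s z))) - ?c (\<lambda>z. P z * (M z * exp (T t z)))"
        by (rule circle_mean_lincomb(2)) (intro continuous_intros con P M j r contT)+
      also have "?c (\<lambda>z. (P z * T s z - P z * T t z)) = ?c (\<lambda>z. P z * T s z) - ?c (\<lambda>z. P z * T t z)"
        by (rule circle_mean_lincomb(2)) (intro continuous_intros con P M j r contT)+
      finally have "G s j - G t j = - ?c D" by (simp add: G_def lin)
      then have "norm (G s j - G t j) = norm (?c D)" by simp
      also have "\<dots> \<le> r j * (B * (\<kappa> * (n * B * d)))"
      proof (rule circle_mean_bound[OF con[OF contD j] r(1)[OF j]])
        fix z assume "z \<in> sphere (c j) (r j)"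
        then have z: "z \<in> K" using r(2)[OF j] by blast
        have "norm (M z * (exp (T s z) - exp (T t z)) - (T s z - T t z)) \<le> \<kappa> * norm (T s z - T t z)"
          by (rule \<eta>(3)) (use M2 T_small z s t in auto)
        also have "\<dots> \<le> \<kappa> * (n * B * d)" using T_diff[OF z _ d0, OF st] kap by (intro mult_left_mono) auto
        finally show "norm (D z) \<le> B * (\<kappa> * (n * B * d))"
          unfolding D_def norm_mult by (intro mult_mono) (use B z in auto)
      qed
      also have "\<dots> \<le> B * (B * (1 / (2 * n * B ^ 3) * (n * B * d)))"
        using B r(1)[OF j] j kap d0 n by (intro mult_mono) (auto intro!: mult_nonneg_nonneg)
      also have "\<dots> = d / 2" using B n by (simp add: power3_eq_cube)
      finally show "norm (G s j - G t j) \<le> d / 2" .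
    qed auto
    have "norm (M z * exp (T t z) - 1) \<le> \<epsilon>" if "z \<in> K" for z
    proof -
      have "norm (T t z) \<le> \<eta>" by (rule T_small[OF that]) (rule t(1))
      then show ?thesis using \<eta>(2)[OF M2[OF that]] kap(2) by (meson order_trans)
    qed
    moreover have "circle_mean (c j) (r j) (\<lambda>z. P z * (M z * exp (T t z))) = 0" if "j \<in> I" for j
      using t(2)[OF that] by (simp add: G_def)
    ultimately show ?thesis by blast
  qed
  show ?thesis
  proof (intro exI[of _ \<delta>] conjI allI impI)
    show "\<delta> > 0" by (rule del(1))
  next
    fix M :: "complex \<Rightarrow> complex" assume M: "continuous_on K M" "\<forall>z\<in>K. norm (M z - 1) \<le> \<delta>"
    show "\<exists>t. (\<forall>z\<in>K. norm (M z * exp (\<Sum>i\<in>I. t i * u i z) - 1) \<le> \<epsilon>) \<and>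
        (\<forall>j\<in>I. circle_mean (c j) (r j) (\<lambda>z. P z * (M z * exp (\<Sum>i\<in>I. t i * u i z))) = 0)"
      by (rule main[unfolded T_def, OF M(1)]) (rule M(2)[rule_format])
  qed
qed

section \<open>Primitives and cuts of the plane\<close>

text \<open>
  Integration from a base point along any path in \<open>S\<close>. On a disc the result differs from a local
  primitive by a constant, as the closed path through both points has period zero.
\<close>

lemma primitive_of_zero_periods:
  assumes S: "open S" "connected S" and \<phi>: "\<phi> holomorphic_on S"
    and zero: "\<And>\<gamma>. \<lbrakk>valid_path \<gamma>; path_image \<gamma> \<subseteq> S; pathfinish \<gamma> = pathstart \<gamma>\<rbrakk> \<Longrightarrow> contour_integral \<gamma> \<phi> = 0"
  obtains F where "\<And>z. z \<in> S \<Longrightarrow> (F has_field_derivative \<phi> z) (at z)"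
proof (cases "S = {}")
  case True then show ?thesis using that by blast
next
  case False
  then obtain a where a: "a \<in> S" by blast
  define g where "g x = (SOME g. valid_path g \<and> path_image g \<subseteq> S \<and> pathstart g = a \<and> pathfinish g = x)" for x
  have g: "valid_path (g x) \<and> path_image (g x) \<subseteq> S \<and> pathstart (g x) = a \<and> pathfinish (g x) = x" if xS: "x \<in> S" for x
  proof -
    obtain g where "polynomial_function g" "path_image g \<subseteq> S" "pathstart g = a" "pathfinish g = x"
      using connected_open_polynomial_connected[OF S a xS] by blast
    then have "valid_path g \<and> path_image g \<subseteq> S \<and> pathstart g = a \<and> pathfinish g = x"
      by (simp add: valid_path_polynomial_function)
    then show ?thesis unfolding g_def
      by (rule someI[of "\<lambda>g. valid_path g \<and> path_image g \<subseteq> S \<and> pathstart g = a \<and> pathfinish g = x"])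
  qed
  define F where "F x = contour_integral (g x) \<phi>" for x
  have "(F has_field_derivative \<phi> x) (at x)" if x: "x \<in> S" for x
  proof -
    obtain d where d: "d > 0" "ball x d \<subseteq> S" using S x open_contains_ball by blast
    have "\<phi> holomorphic_on ball x d" using \<phi> d holomorphic_on_subset by blast
    then obtain \<Phi> where \<Phi>: "\<And>y. y \<in> ball x d \<Longrightarrow> (\<Phi> has_field_derivative \<phi> y) (at y within ball x d)"
      using holomorphic_convex_primitive'[of "ball x d" \<phi>] by auto
    have "F y = \<Phi> y + (F x - \<Phi> x)" if y: "y \<in> ball x d" for y
    proof -
      have seg: "closed_segment x y \<subseteq> ball x d" using y d by (intro closed_segment_subset) auto
      have yS: "y \<in> S" using y d by blast
      have i: "\<phi> contour_integrable_on g x" "\<phi> contour_integrable_on g y" "\<phi> contour_integrable_on linepath x y"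
        using g[OF x] g[OF yS] seg d \<phi> S
        by (auto intro!: contour_integrable_holomorphic_simple[of \<phi> S])
      have "contour_integral (g x +++ linepath x y +++ reversepath (g y)) \<phi> = 0"
        by (rule zero) (use g[OF x] g[OF yS] seg d in \<open>auto simp: path_image_join\<close>)
      then have "F x + (contour_integral (linepath x y) \<phi> - F y) = 0"
        using i g[OF x] g[OF yS]
        by (simp add: F_def contour_integrable_reversepath contour_integral_reversepath)
      moreover have "contour_integral (linepath x y) \<phi> = \<Phi> y - \<Phi> x"
        using contour_integral_primitive[of "ball x d" \<Phi> \<phi> "linepath x y"] \<Phi> seg
        by (simp add: contour_integral_unique)
      ultimately show ?thesis by (simp add: algebra_simps)
    qed
    note eq = this
    have "((\<lambda>y. \<Phi> y + (F x - \<Phi> x)) has_field_derivative \<phi> x) (at x)"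
      using \<Phi>[of x] d by (auto intro!: derivative_eq_intros simp: at_within_open[of x "ball x d"])
    then show ?thesis
    proof (rule has_field_derivative_transform_within_open)
      show "open (ball x d)" "x \<in> ball x d" using d by auto
      show "\<Phi> y + (F x - \<Phi> x) = F y" if "y \<in> ball x d" for y using eq[OF that] by simp
    qed
  qed
  then show ?thesis using that by blast
qed

lemma primitive_of_zero_residues:
  assumes A: "finite A" and \<phi>: "\<phi> holomorphic_on - A" and res: "\<And>a. a \<in> A \<Longrightarrow> residue \<phi> a = 0"
  obtains F where "\<And>z. z \<notin> A \<Longrightarrow> (F has_field_derivative \<phi> z) (at z)"
proof -
  have "connected (UNIV - A)"
    by (rule connected_open_delete_finite) (use A in auto)
  then have con: "open (- A)" "connected (- A)"
    using A by (auto simp: Compl_eq_Diff_UNIV finite_imp_closed open_Compl)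
  obtain F where "\<And>z. z \<in> - A \<Longrightarrow> (F has_field_derivative \<phi> z) (at z)"
  proof (rule primitive_of_zero_periods[OF con \<phi>])
    fix \<gamma> assume "valid_path \<gamma>" "path_image \<gamma> \<subseteq> - A" "pathfinish \<gamma> = pathstart \<gamma>"
    then have "contour_integral \<gamma> \<phi> = 2 * pi * \<i> * (\<Sum>p\<in>A. winding_number \<gamma> p * residue \<phi> p)"
      using A \<phi> by (intro Residue_theorem[of UNIV]) (auto simp: Compl_eq_Diff_UNIV)
    then show "contour_integral \<gamma> \<phi> = 0" using res by simp
  qed blast
  then show ?thesis using that by blast
qed

text \<open>
  A quantitative form of the fact that a function with zero derivative on a connected set is constant. The compact set
  \<open>H\<close> collects chains of discs that lead from \<open>x0\<close> to the points of \<open>K\<close>; it is in general larger than \<open>K\<close>, which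
  may be disconnected.
\<close>

lemma derivative_controls_values:
  assumes D: "open D" "connected D" "x0 \<in> D" and K: "compact K" "K \<subseteq> D"
  obtains H L where "compact H" "H \<subseteq> D" "L > 0"
    "\<And>F F' e z. (\<And>z. z \<in> D \<Longrightarrow> (F has_field_derivative F' z) (at z)) \<Longrightarrow> F x0 = 0 \<Longrightarrow> e \<ge> 0 \<Longrightarrow>
       (\<And>z. z \<in> H \<Longrightarrow> norm (F' z) \<le> e) \<Longrightarrow> z \<in> K \<Longrightarrow> norm (F z :: complex) \<le> L * e"
proof -
  define Q where "Q H L y \<longleftrightarrow> compact H \<and> H \<subseteq> D \<and> L > 0 \<and> (\<forall>F F' e. (\<forall>z\<in>D. (F has_field_derivative F' z) (at z)) \<longrightarrow>
     F x0 = 0 \<longrightarrow> e \<ge> 0 \<longrightarrow> (\<forall>z\<in>H. norm (F' z) \<le> e) \<longrightarrow> norm (F y :: complex) \<le> L * e)" for H L y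
  have move: "Q (H \<union> cball x d) (L + 2 * d) z" if Q: "Q H L y" and d: "d > 0" "cball x d \<subseteq> D" "y \<in> cball x d" "z \<in> cball x d" for H L x y z d
    unfolding Q_def
  proof (intro conjI allI impI)
    fix F F' :: "complex \<Rightarrow> complex" and e :: real
    assume F: "\<forall>z\<in>D. (F has_field_derivative F' z) (at z)" "F x0 = 0" "e \<ge> 0" "\<forall>z\<in>H \<union> cball x d. norm (F' z) \<le> e"
    have "norm (F z - F y) \<le> e * norm (z - y)"
    proof (rule field_differentiable_bound[where S = "cball x d" and f' = F'])
      show "(F has_field_derivative F' w) (at w within cball x d)" if "w \<in> cball x d" for w
        using F(1) d(2) that has_field_derivative_at_within by blast
      show "norm (F' w) \<le> e" if "w \<in> cball x d" for w using F(4) that by blast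
    qed (use d in auto)
    also have "\<dots> \<le> e * (2 * d)"
    proof -
      have "norm (z - y) \<le> 2 * d" 
        using dist_triangle_le[of z x y "2 * d"] d(3,4) by (auto simp: dist_norm norm_minus_commute)
      then show ?thesis using F(3) by (rule mult_left_mono)
    qed
    finally have "norm (F z - F y) \<le> e * (2 * d)" .
    moreover have "norm (F y) \<le> L * e" using Q F unfolding Q_def by blast
    ultimately show "norm (F z) \<le> (L + 2 * d) * e"
      using norm_triangle_sub[of "F z" "F y"] by (simp add: algebra_simps)
  qed (use Q d in \<open>auto simp: Q_def\<close>)
  have all: "\<exists>H L. Q H L y" if "y \<in> D" for y
  proof (rule connected_induction_simple[OF D(2,3) that])
    show "\<exists>H L. Q H L x0" by (rule exI[of _ "{}"], rule exI[of _ 1]) (auto simp: Q_def)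
    fix x assume x: "x \<in> D"
    then obtain d where d: "d > 0" "cball x d \<subseteq> D" using D(1) open_contains_cball by blast
    show "\<exists>T. openin (top_of_set D) T \<and> x \<in> T \<and> (\<forall>u\<in>T. \<forall>v\<in>T. (\<exists>H L. Q H L u) \<longrightarrow> (\<exists>H L. Q H L v))"
    proof (rule exI[of _ "ball x d"], intro conjI ballI impI)
      show "openin (top_of_set D) (ball x d)"
        by (rule open_openin_trans[OF D(1)]) (use d ball_subset_cball in \<open>auto simp: subset_iff\<close>)
      fix u v assume uv: "u \<in> ball x d" "v \<in> ball x d" "\<exists>H L. Q H L u"
      then show "\<exists>H L. Q H L v"
        using move[OF _ d] ball_subset_cball by (meson subsetD)
    qed (use d in auto)
  qed
  have "\<exists>d H L. d > 0 \<and> (\<forall>z\<in>ball x d. Q H L z)" if x: "x \<in> D" for x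
  proof -
    obtain d where d: "d > 0" "cball x d \<subseteq> D" using D(1) x open_contains_cball by blast
    obtain H L where "Q H L x" using all[OF x] by blast
    then show ?thesis using move[OF _ d, of H L x] d(1)
      by (metis ball_subset_cball centre_in_cball less_imp_le subsetD)
  qed
  then obtain d H L where dHL: "\<And>x. x \<in> D \<Longrightarrow> d x > 0" "\<And>x z. x \<in> D \<Longrightarrow> z \<in> ball x (d x) \<Longrightarrow> Q (H x) (L x) z"
    by metis
  have "K \<subseteq> (\<Union>x\<in>K. ball x (d x))" using dHL(1) K by force
  then obtain X where X: "X \<subseteq> K" "finite X" "K \<subseteq> (\<Union>x\<in>X. ball x (d x))"
    using compactE_image[OF K(1), of K "\<lambda>x. ball x (d x)"] by auto
  have QX: "Q (H x) (L x) x" if "x \<in> X" for x using dHL[of x] that X K by auto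
  have Lpos: "L x > 0" if "x \<in> X" for x using QX[OF that] by (simp add: Q_def)
  show ?thesis
  proof (rule that[of "\<Union>x\<in>X. H x" "1 + (\<Sum>x\<in>X. L x)"])
    show "compact (\<Union>x\<in>X. H x)" using X QX by (intro compact_UN) (auto simp: Q_def)
    show "(\<Union>x\<in>X. H x) \<subseteq> D" using QX unfolding Q_def by blast
    show "0 < 1 + (\<Sum>x\<in>X. L x)" using Lpos by (smt (verit) sum_nonneg)
    fix F F' :: "complex \<Rightarrow> complex" and e z 
    assume F: "\<And>z. z \<in> D \<Longrightarrow> (F has_field_derivative F' z) (at z)" "F x0 = 0" "e \<ge> 0"
      "\<And>z. z \<in> (\<Union>x\<in>X. H x) \<Longrightarrow> norm (F' z) \<le> e" "z \<in> K"
    obtain x where x: "x \<in> X" "z \<in> ball x (d x)" using X F(5) by blast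
    then have "Q (H x) (L x) z" using dHL X K by blast
    then have "norm (F z) \<le> L x * e" using F x unfolding Q_def by (metis UN_I)
    also have "L x \<le> (\<Sum>x\<in>X. L x)" using x X Lpos by (intro member_le_sum) (auto intro: less_imp_le)
    then have "L x * e \<le> (1 + (\<Sum>x\<in>X. L x)) * e" using F(3) by (intro mult_right_mono) auto
    finally show "norm (F z) \<le> (1 + (\<Sum>x\<in>X. L x)) * e" .
  qed
qed

lemma punctured_discs:
  assumes "open D" "finite A" "a \<in> D"
  shows "\<exists>r>0. cball a r - {a} \<subseteq> D - A"
proof -
  have "open (D - (A - {a}))" using assms by (intro open_Diff finite_imp_closed) auto
  then obtain r where "r > 0" "cball a r \<subseteq> D - (A - {a})"
    using assms(3) open_contains_cball_eq by blast
  then show ?thesis by (intro exI[of _ r]) auto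
qed

text \<open>
  The cut \<open>T\<close> is an arc from \<open>c\<close> to \<open>a\<close> in the complement of \<open>K\<close> that avoids the other points of \<open>A\<close>; an arc does not separate
  the plane.
\<close>

lemma cut_to_finite_point:
  fixes K A :: "complex set"
  assumes K: "compact K" and A: "finite A" "K \<inter> A = {}" and c: "c \<notin> K" "c \<notin> A"
    and a: "connected_component (- K) c a" "a \<noteq> c" "a \<in> A"
  obtains D T where "open D" "connected D" "K \<subseteq> D" "D \<inter> A = {}" "c \<notin> D"
    "\<And>b. b \<in> A \<Longrightarrow> b \<noteq> a \<Longrightarrow> \<exists>r>0. cball b r - {b} \<subseteq> D"
    "bounded (- D)" "connected T" "c \<in> T" "a \<in> T" "T \<inter> D = {}"
proof -
  define W where "W = connected_component_set (- K) c - (A - {a})"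
  have "open (- K)" using compact_imp_closed[OF K] by (rule open_Compl)
  then have o: "open (connected_component_set (- K) c)" by (rule open_connected_component)
  have "open W" unfolding W_def using o A by (intro open_Diff finite_imp_closed) auto
  moreover have "connected W" unfolding W_def
    by (rule connected_open_delete_finite) (use o A in auto)
  ultimately have "path_connected W" by (simp add: connected_open_path_connected)
  moreover have "c \<in> W" "a \<in> W" using c a by (auto simp: W_def)
  ultimately obtain g where g: "arc g" "path_image g \<subseteq> W" "pathstart g = c" "pathfinish g = a"
    using a(2) unfolding path_connected_arcwise by metis
  define T where "T = path_image g"
  have T: "closed T" "bounded T" "connected T" "c \<in> T" "a \<in> T"
    using g arc_imp_path[OF g(1)] 
    by (auto simp: T_def closed_path_image bounded_path_image connected_path_image)
  have conT: "connected (- T)" unfolding T_def by (rule connected_arc_complement) (use g in auto)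
  have oT: "open (- T)" using T by (simp add: open_Compl)
  have WK: "W \<inter> K = {}" unfolding W_def using connected_component_subset[of "- K" c] by auto
  show ?thesis
  proof (rule that[of "- T - A" T])
    show "open (- T - A)" using oT A by (intro open_Diff finite_imp_closed) auto
    show "connected (- T - A)" by (rule connected_open_delete_finite) (use oT conT A in auto)
    show "K \<subseteq> - T - A" using WK g(2) A(2) by (auto simp: T_def)
    have "- (- T - A) = T \<union> A" by auto
    then show "bounded (- (- T - A))" using T A finite_imp_bounded by simp
    fix b assume b: "b \<in> A" "b \<noteq> a"
    then have "b \<in> - T" using g(2) by (auto simp: T_def W_def)
    then show "\<exists>r>0. cball b r - {b} \<subseteq> - T - A" by (rule punctured_discs[OF oT A(1)])
  qed (use T c in auto)
qed

lemma unbounded_component_contains_exterior: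
  fixes K :: "complex set"
  assumes "K \<subseteq> ball 0 R" "\<not> bounded (connected_component_set (- K) c)" "R \<le> norm z"
  shows "connected_component (- K) c z"
proof -
  obtain y where y: "connected_component (- K) c y" "norm y > R"
    using assms(2) unfolding bounded_iff by (auto simp: not_le)
  have "connected (- ball (0::complex) R)"
    by (rule connected_complement_bounded_convex) auto
  then have "connected_component (- K) y z"
    unfolding connected_component_def using assms y(2) by (intro exI[of _ "- ball 0 R"]) auto
  with y(1) show ?thesis by (rule connected_component_trans)
qed

text \<open>
  The counterpart with infinity in place of \<open>a\<close>. The inversion \<open>w = 1 / (z - p)\<close> turns a
  cut from \<open>c\<close> to infinity into an arc that ends at \<open>0\<close>, to which the theorem that arcs do not separate
  the plane applies.
\<close>

lemma cut_to_infinity: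
  fixes K A :: "complex set"
  assumes K: "compact K" and A: "finite A" "K \<inter> A = {}" and c: "c \<notin> K" "c \<notin> A"
    and unb: "\<not> bounded (connected_component_set (- K) c)"
  obtains D T where "open D" "connected D" "K \<subseteq> D" "D \<inter> A = {}" "c \<notin> D"
    "\<And>b. b \<in> A \<Longrightarrow> \<exists>r>0. cball b r - {b} \<subseteq> D"
    "connected T" "c \<in> T" "\<not> bounded T" "T \<inter> D = {}"
proof -
  have "bounded (K \<union> A \<union> {c})" using K A by (simp add: compact_imp_bounded finite_imp_bounded)
  then obtain R0 where R0: "\<And>z. z \<in> K \<union> A \<union> {c} \<Longrightarrow> norm z \<le> R0" unfolding bounded_iff by blast
  define R where "R = R0 + 1"
  have R: "K \<subseteq> ball 0 R" "A \<subseteq> ball 0 R" "norm c < R" using R0 by (force simp: R_def)+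
  have Rpos: "R > 0" using R(3) norm_ge_zero[of c] by linarith
  define p where "p = complex_of_real R"
  have p: "p \<notin> K" "p \<notin> A" "p \<noteq> c" "norm p = R" using R Rpos by (auto simp: p_def)
  define C where "C = connected_component_set (- K) c"
  have "open (- K)" using compact_imp_closed[OF K] by (rule open_Compl)
  then have oC: "open C" unfolding C_def by (rule open_connected_component)
  have CK: "C \<inter> K = {}" unfolding C_def using connected_component_subset[of "- K" c] by auto
  have ext: "z \<in> C" if "R \<le> norm z" for z
    using unbounded_component_contains_exterior[OF R(1) unb that] by (simp add: C_def)
  define W where "W = {w. w = 0 \<or> p + 1 / w \<in> C - A}"
  define W' where "W' = {w. w \<noteq> 0 \<and> p + 1 / w \<in> C - A}"
  define r where "r = 1 / (2 * R)"
  have r: "r > 0" using Rpos by (simp add: r_def)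
  \<comment> \<open>A neighbourhood of infinity belongs to the component of \<open>c\<close>, so the point \<open>0\<close> can be added in the \<open>w\<close>-plane.\<close>
  have ballW: "ball 0 r \<subseteq> W"
  proof
    fix w :: complex assume w: "w \<in> ball 0 r"
    show "w \<in> W"
    proof (cases "w = 0")
      case False
      then have "norm (1 / w) > 2 * R"
        using w Rpos by (simp add: norm_divide r_def field_simps)
      then have "R < norm (p + 1 / w)"
        using norm_triangle_ineq2[of "1/w" "-p"] p(4) by (simp add: add.commute)
      then show ?thesis using ext R by (auto simp: W_def)
    qed (simp add: W_def)
  qed
  have oW': "open W'"
  proof -
    have "open ((\<lambda>w. p + 1 / w) -` (C - A) \<inter> (- {0}))"
      by (rule continuous_open_preimage[unfolded Int_commute[of _ "_ -` _"]])
        (use oC A in \<open>auto intro!: continuous_intros open_Diff finite_imp_closed\<close>)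
    also have "(\<lambda>w. p + 1 / w) -` (C - A) \<inter> (- {0}) = W'" by (auto simp: W'_def)
    finally show ?thesis .
  qed
  have W_eq: "W = W' \<union> ball 0 r" using ballW r by (auto simp: W_def W'_def)
  have oW: "open W" unfolding W_eq using oW' by auto
  have conW': "connected W'"
  proof -
    have "connected (C - (A \<union> {p}))"
      by (rule connected_open_delete_finite) (use oC A in \<open>auto simp: C_def\<close>)
    then have "connected ((\<lambda>z. 1 / (z - p)) ` (C - (A \<union> {p})))"
      by (intro connected_continuous_image continuous_intros) auto
    also have "(\<lambda>z. 1 / (z - p)) ` (C - (A \<union> {p})) = W'"
    proof (intro equalityI subsetI)
      fix w assume "w \<in> W'"
      then have "w = 1 / ((p + 1 / w) - p)" "p + 1 / w \<in> C - (A \<union> {p})" by (auto simp: W'_def)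
      then show "w \<in> (\<lambda>z. 1 / (z - p)) ` (C - (A \<union> {p}))" by blast
    qed (auto simp: W'_def)
    finally show ?thesis .
  qed
  have "connected W"
  proof -
    have "of_real (r / 2) \<in> ball (0::complex) r" "of_real (r/2) \<noteq> (0::complex)" using r by auto
    moreover from this have "of_real (r / 2) \<in> W" using ballW by blast
    ultimately have "of_real (r / 2) \<in> W' \<inter> ball 0 r" unfolding W_def W'_def by blast
    then show ?thesis unfolding W_eq using conW' by (intro connected_Un) auto
  qed
  then have pcW: "path_connected W" using oW by (simp add: connected_open_path_connected)
  define c' where "c' = 1 / (c - p)"
  have c': "c' \<noteq> 0" "c' \<in> W" "p + 1 / c' = c" using p c by (auto simp: c'_def W_def C_def)
  have "0 \<in> W" by (simp add: W_def)
  then obtain g where g: "arc g" "path_image g \<subseteq> W" "pathstart g = c'" "pathfinish g = 0"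
    using pcW c' unfolding path_connected_arcwise by metis
  define T1 where "T1 = path_image g"
  have T1: "closed T1" "0 \<in> T1" "c' \<in> T1"
    using g arc_imp_path[OF g(1)] pathstart_in_path_image[of g] pathfinish_in_path_image[of g]
    by (auto simp: T1_def closed_path_image)
  have conT1: "connected (- T1)" unfolding T1_def by (rule connected_arc_complement) (use g in auto)
  define D0 where "D0 = {z. z \<noteq> p \<and> 1 / (z - p) \<notin> T1}"
  have oD0: "open D0"
  proof -
    have "open ((\<lambda>z. 1 / (z - p)) -` (- T1) \<inter> (- {p}))"
      by (rule continuous_open_preimage[unfolded Int_commute[of _ "_ -` _"]])
        (use T1 in \<open>auto intro!: continuous_intros\<close>)
    also have "(\<lambda>z. 1 / (z - p)) -` (- T1) \<inter> (- {p}) = D0" by (auto simp: D0_def)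
    finally show ?thesis .
  qed
  have conD0: "connected D0"
  proof -
    have "connected ((\<lambda>w. p + 1 / w) ` (- T1))"
      by (intro connected_continuous_image continuous_intros conT1) (use T1 in auto)
    also have "(\<lambda>w. p + 1 / w) ` (- T1) = D0"
    proof (intro equalityI subsetI)
      fix z assume "z \<in> D0"
      then have "z = p + 1 / (1 / (z - p))" "1 / (z - p) \<in> - T1" by (auto simp: D0_def)
      then show "z \<in> (\<lambda>w. p + 1 / w) ` (- T1)" by blast
    next
      fix z assume "z \<in> (\<lambda>w. p + 1 / w) ` (- T1)"
      then obtain w where "w \<notin> T1" "z = p + 1 / w" by auto
      moreover from this have "w \<noteq> 0" using T1 by auto
      ultimately show "z \<in> D0" by (auto simp: D0_def)
    qed
    finally show ?thesis .
  qed
  have outside: "z \<in> D0" if "z \<noteq> p" "z \<notin> C - A" for z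
  proof -
    have "1 / (z - p) \<notin> W" using that by (auto simp: W_def)
    then show ?thesis using g(2) that by (auto simp: D0_def T1_def)
  qed
  define T where "T = (\<lambda>w. p + 1 / w) ` (T1 - {0})"
  have T1_eq: "T1 - {0} = g ` {0..<1}"
  proof -
    have "T1 = g ` {0..1}" by (simp add: T1_def path_image_def)
    moreover have "{0..1::real} = insert 1 {0..<1}" by auto
    moreover have "g 1 = 0" using g(4) by (simp add: pathfinish_def)
    moreover have "g t \<noteq> 0" if "t \<in> {0..<1}" for t
    proof
      assume "g t = 0"
      then have "g t = g 1" using \<open>g 1 = 0\<close> by simp
      then have "t = 1" using g(1) that unfolding arc_def by (auto dest: inj_onD)
      then show False using that by simp
    qed
    ultimately show ?thesis by auto
  qed
  have cg: "continuous_on {0..1} g" using arc_imp_path[OF g(1)] by (simp add: path_def)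
  have "connected (T1 - {0})" unfolding T1_eq
    by (intro connected_continuous_image continuous_on_subset[OF cg]) auto
  then have conT: "connected T" unfolding T_def
    by (intro connected_continuous_image continuous_intros) auto
  have unbT: "\<not> bounded T"
  proof
    assume "bounded T"
    then obtain B where B: "B > 0" "\<And>z. z \<in> T \<Longrightarrow> norm z \<le> B" using bounded_pos by blast
    define \<epsilon> where "\<epsilon> = 1 / (B + R + 1)"
    have eps: "\<epsilon> > 0" using B Rpos by (simp add: \<epsilon>_def)
    have "continuous (at 1 within {0..1}) g" using cg by (simp add: continuous_on_eq_continuous_within)
    then obtain d where d: "d > 0" "\<And>t. t \<in> {0..1} \<Longrightarrow> dist t 1 < d \<Longrightarrow> dist (g t) (g 1) < \<epsilon>"
      unfolding continuous_within_eps_delta using eps by blast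
    define t where "t = max 0 (1 - d / 2)"
    have t: "t \<in> {0..<1}" "dist t 1 < d" using d by (auto simp: t_def dist_real_def)
    have "g 1 = 0" using g(4) by (simp add: pathfinish_def)
    then have gt: "norm (g t) < \<epsilon>" using d(2)[of t] t by simp
    have gT: "g t \<in> T1 - {0}" using t T1_eq by blast
    then have "norm (p + 1 / g t) \<le> B" using B(2) by (auto simp: T_def)
    moreover have "norm (1 / g t) > B + R + 1"
      using gt gT eps B Rpos by (simp add: norm_divide \<epsilon>_def field_simps)
    ultimately show False
      using norm_triangle_ineq2[of "1 / g t" "- p"] p(4) by (simp add: add.commute)
  qed
  show ?thesis
  proof (rule that[of "D0 - A" T])
    show "open (D0 - A)" using oD0 A by (intro open_Diff finite_imp_closed) auto
    show "connected (D0 - A)" by (rule connected_open_delete_finite) (use oD0 conD0 A in auto)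
    have "z \<in> D0" if z: "z \<in> K" for z
      by (rule outside) (use z CK p in auto)
    then show "K \<subseteq> D0 - A" using A(2) by blast
    show "c \<notin> D0 - A" using T1 by (simp add: D0_def c'_def)
    show "\<exists>r>0. cball b r - {b} \<subseteq> D0 - A" if b: "b \<in> A" for b
    proof (rule punctured_discs[OF oD0 A(1)])
      show "b \<in> D0" by (rule outside) (use b p in auto)
    qed
    show "c \<in> T" unfolding T_def by (rule image_eqI[of _ _ c']) (use T1(3) c' in auto)
    show "T \<inter> (D0 - A) = {}" by (auto simp: T_def D0_def)
  qed (use conT unbT in auto)
qed

section \<open>Removing critical points\<close>

text \<open>
  A system of circles, one for each point of \<open>A\<close>, that detects whether a function on \<open>- A\<close> has a primitive. The last
  clause provides the dual functions that linearise the correction of periods: \<open>Z * v i\<close> has mean \<open>1\<close>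
  over circle \<open>i\<close> and mean \<open>0\<close> over the others.
\<close>

definition period_system :: "complex set \<Rightarrow> (complex \<Rightarrow> complex) \<Rightarrow> (complex \<Rightarrow> real) \<Rightarrow> bool" where
  "period_system A c r \<longleftrightarrow> finite A \<and> (\<forall>i\<in>A. r i > 0 \<and> sphere (c i) (r i) \<inter> A = {}) \<and>
    (\<forall>\<phi>. \<phi> holomorphic_on - A \<longrightarrow> (\<forall>i\<in>A. circle_mean (c i) (r i) \<phi> = 0) \<longrightarrow>
       (\<exists>F. \<forall>z. z \<notin> A \<longrightarrow> (F has_field_derivative \<phi> z) (at z))) \<and>
    (\<forall>Z. Z holomorphic_on UNIV \<longrightarrow> (\<forall>a\<in>A. Z a \<noteq> 0) \<longrightarrow>
       (\<exists>v. (\<forall>i\<in>A. v i holomorphic_on - A) \<and>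
          (\<forall>i\<in>A. \<forall>j\<in>A. circle_mean (c j) (r j) (\<lambda>z. Z z * v i z) = (if i = j then 1 else 0))))"

lemma circle_mean_simple_pole:
  assumes Z: "Z holomorphic_on UNIV" "Z a \<noteq> 0" and r: "r > 0" "a \<notin> sphere c r"
  shows "circle_mean c r (\<lambda>z. Z z * (1 / (Z a * (z - a)))) = (if a \<in> ball c r then 1 else 0)"
proof (cases "a \<in> ball c r")
  case True
  then have "((\<lambda>z. (Z z / Z a) / (z - a)) has_contour_integral (2 * of_real pi * \<i> * (Z a / Z a))) (circlepath c r)"
    by (intro Cauchy_integral_circlepath_simple holomorphic_intros holomorphic_on_subset[OF Z(1)])
      (use Z in \<open>auto simp: dist_norm norm_minus_commute\<close>)
  then have "contour_integral (circlepath c r) (\<lambda>z. (Z z / Z a) / (z - a)) = 2 * pi * \<i>"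
    using Z(2) by (simp add: contour_integral_unique)
  then show ?thesis using True by (simp add: circle_mean_def)
next
  case False
  then have a: "a \<notin> cball c r" using r by auto
  have "((\<lambda>z. Z z * (1 / (Z a * (z - a)))) has_contour_integral 0) (circlepath c r)"
    by (rule Cauchy_theorem_convex_simple[of _ "cball c r"])
      (use a r Z in \<open>auto intro!: holomorphic_intros holomorphic_on_subset[OF Z(1)]\<close>)
  then show ?thesis using False by (simp add: circle_mean_def contour_integral_unique)
qed

lemma circle_mean_residue:
  assumes A: "finite A" and \<phi>: "\<phi> holomorphic_on - A" and r: "r > 0" "cball a r \<inter> A = {a}"
  shows "circle_mean a r \<phi> = residue \<phi> a"
proof -
  have "(\<phi> has_contour_integral 2 * pi * \<i> * residue \<phi> a) (circlepath a r)"
  proof (rule base_residue[of "- (A - {a})"])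
    show "open (- (A - {a}))" using A by (intro open_Compl finite_imp_closed) auto
    show "\<phi> holomorphic_on - (A - {a}) - {a}" by (rule holomorphic_on_subset[OF \<phi>]) auto
  qed (use r in auto)
  then show ?thesis by (simp add: circle_mean_def contour_integral_unique)
qed

lemma isolated_disc:
  assumes "cball j r \<inter> A = {j}" "i \<in> A" "r > 0"
  shows "i \<notin> sphere j r" "i \<in> ball j r \<longleftrightarrow> i = j"
proof -
  have "i \<in> cball j r \<longleftrightarrow> i = j" using assms by blast
  then show "i \<notin> sphere j r" "i \<in> ball j r \<longleftrightarrow> i = j" using assms(3) by (cases "i = j"; force)+
qed

text \<open>
  The mean over a small circle around \<open>a\<close> is the residue at \<open>a\<close>. The dual function of \<open>i\<close> has a simple pole at \<open>i\<close> only.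
\<close>

lemma period_system_small_circles:
  assumes A: "finite A" and r: "\<And>a. a \<in> A \<Longrightarrow> r a > 0" "\<And>a. a \<in> A \<Longrightarrow> cball a (r a) \<inter> A = {a}"
  shows "period_system A (\<lambda>a. a) r"
  unfolding period_system_def
proof (intro conjI allI impI ballI)
  have off: "i \<notin> sphere j (r j)" "i \<in> ball j (r j) \<longleftrightarrow> i = j" if "i \<in> A" "j \<in> A" for i j
    using isolated_disc[OF r(2)[OF that(2)] that(1) r(1)[OF that(2)]] by auto
  show "sphere j (r j) \<inter> A = {}" if "j \<in> A" for j using off(1) that by blast
  fix \<phi> assume "\<phi> holomorphic_on - A" "\<forall>i\<in>A. circle_mean i (r i) \<phi> = 0"
  then have "residue \<phi> a = 0" if "a \<in> A" for a
    using circle_mean_residue[OF A, of \<phi> "r a" a] r that by simp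
  then show "\<exists>F. \<forall>z. z \<notin> A \<longrightarrow> (F has_field_derivative \<phi> z) (at z)"
    using primitive_of_zero_residues[OF A \<open>\<phi> holomorphic_on - A\<close>] by blast
next
  have off: "i \<notin> sphere j (r j)" "i \<in> ball j (r j) \<longleftrightarrow> i = j" if "i \<in> A" "j \<in> A" for i j
    using isolated_disc[OF r(2)[OF that(2)] that(1) r(1)[OF that(2)]] by auto
  fix Z :: "complex \<Rightarrow> complex" assume Z: "Z holomorphic_on UNIV" "\<forall>a\<in>A. Z a \<noteq> 0"
  show "\<exists>v. (\<forall>i\<in>A. v i holomorphic_on - A) \<and>
          (\<forall>i\<in>A. \<forall>j\<in>A. circle_mean j (r j) (\<lambda>z. Z z * v i z) = (if i = j then 1 else 0))"
  proof (intro exI[of _ "\<lambda>i z. 1 / (Z i * (z - i))"] conjI ballI)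
    fix i j assume ij: "i \<in> A" "j \<in> A"
    show "(\<lambda>z. 1 / (Z i * (z - i))) holomorphic_on - A"
      by (intro holomorphic_intros) (use ij Z in auto)
    show "circle_mean j (r j) (\<lambda>z. Z z * (1 / (Z i * (z - i)))) = (if i = j then 1 else 0)"
      using circle_mean_simple_pole[OF Z(1) _ r(1)[OF ij(2)] off(1)[OF ij]] Z(2) ij off(2)[OF ij] by simp
  qed
qed (use A r in auto)

text \<open>
  The mean over the outer circle is the sum of all residues, hence the residue at \<open>a\<close> once the others vanish. As
  the outer circle encloses every pole, the dual functions of the other points get a compensating pole at \<open>a\<close>.
\<close>

lemma period_system_outer_circle:
  assumes A: "finite A" "a \<in> A" and r: "\<And>b. b \<in> A \<Longrightarrow> b \<noteq> a \<Longrightarrow> r b > 0" "\<And>b. b \<in> A \<Longrightarrow> b \<noteq> a \<Longrightarrow> cball b (r b) \<inter> A = {b}"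
    and R: "A \<subseteq> ball 0 R"
  shows "period_system A (\<lambda>b. if b = a then 0 else b) (\<lambda>b. if b = a then R else r b)"
proof -
  have Rpos: "R > 0" using A(2) R by (metis ball_eq_empty empty_iff not_le subsetD)
  have off: "i \<notin> sphere j (r j)" "i \<in> ball j (r j) \<longleftrightarrow> i = j" if "i \<in> A" "j \<in> A" "j \<noteq> a" for i j
    using isolated_disc[OF r(2)[OF that(2,3)] that(1) r(1)[OF that(2,3)]] by auto
  have offR: "i \<notin> sphere 0 R" "i \<in> ball 0 R" if "i \<in> A" for i using R that by auto
  let ?c = "\<lambda>b. if b = a then 0 else b" and ?r = "\<lambda>b. if b = a then R else r b"
  have prim: "\<exists>F. \<forall>z. z \<notin> A \<longrightarrow> (F has_field_derivative \<phi> z) (at z)"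
    if \<phi>: "\<phi> holomorphic_on - A" and z: "\<forall>i\<in>A. circle_mean (?c i) (?r i) \<phi> = 0" for \<phi>
  proof -
    have res: "residue \<phi> b = 0" if "b \<in> A" "b \<noteq> a" for b
      using circle_mean_residue[OF A(1) \<phi> r(1)[OF that] r(2)[OF that]] z that by auto
    have "contour_integral (circlepath 0 R) \<phi> = 2 * pi * \<i> * (\<Sum>p\<in>A. winding_number (circlepath 0 R) p * residue \<phi> p)"
      by (rule Residue_theorem[of UNIV]) (use A \<phi> Rpos offR in \<open>auto simp: Compl_eq_Diff_UNIV\<close>)
    also have "(\<Sum>p\<in>A. winding_number (circlepath 0 R) p * residue \<phi> p) = (\<Sum>p\<in>A. if p = a then residue \<phi> a else 0)"
      using res R by (intro sum.cong) (auto simp: winding_number_circlepath)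
    also have "\<dots> = residue \<phi> a" using A by simp
    finally have "residue \<phi> a = circle_mean 0 R \<phi>" by (simp add: circle_mean_def)
    also have "\<dots> = 0" using z A(2) by force
    finally have "residue \<phi> b = 0" if "b \<in> A" for b using res that by (cases "b = a") auto
    then show ?thesis using primitive_of_zero_residues[OF A(1) \<phi>] by blast
  qed
  have dual: "\<exists>v. (\<forall>i\<in>A. v i holomorphic_on - A) \<and>
          (\<forall>i\<in>A. \<forall>j\<in>A. circle_mean (?c j) (?r j) (\<lambda>z. Z z * v i z) = (if i = j then 1 else 0))"
    if Z: "Z holomorphic_on UNIV" "\<forall>a\<in>A. Z a \<noteq> 0" for Z
  proof -
    define k where "k i z = 1 / (Z i * (z - i))" for i z
    have kh: "k i holomorphic_on - A" if "i \<in> A" for i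
      unfolding k_def by (intro holomorphic_intros) (use that Z in auto)
    have sph: "sphere (?c j) (?r j) \<subseteq> - A" "?r j > 0" if "j \<in> A" for j
      using off(1)[OF _ that] offR(1) r(1)[OF that] Rpos by auto
    have kc: "continuous_on (sphere (?c j) (?r j)) (\<lambda>z. Z z * k i z)" if "i \<in> A" "j \<in> A" for i j
      by (intro continuous_intros holomorphic_on_imp_continuous_on holomorphic_on_subset[OF kh[OF that(1)] sph(1)[OF that(2)]]
          holomorphic_on_subset[OF Z(1)]) auto
    have val: "circle_mean (?c j) (?r j) (\<lambda>z. Z z * k i z) = (if j = a \<or> i = j then 1 else 0)" if ij: "i \<in> A" "j \<in> A" for i j
    proof (cases "j = a")
      case True
      then show ?thesis
        using circle_mean_simple_pole[OF Z(1) _ Rpos offR(1)[OF ij(1)]] Z(2) ij offR(2)[OF ij(1)] by (simp add: k_def)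
    next
      case False
      then show ?thesis
        using circle_mean_simple_pole[OF Z(1) _ r(1)[OF ij(2) False] off(1)[OF ij False]] Z(2) ij off(2)[OF ij False]
        by (simp add: k_def)
    qed
    define v where "v i z = (if i = a then k a z else k i z - k a z)" for i z
    have "circle_mean (?c j) (?r j) (\<lambda>z. Z z * v i z) = (if i = j then 1 else 0)" if ij: "i \<in> A" "j \<in> A" for i j
    proof (cases "i = a")
      case True
      then show ?thesis using val[OF ij] by (auto simp: v_def)
    next
      case False
      have "circle_mean (?c j) (?r j) (\<lambda>z. Z z * v i z) = circle_mean (?c j) (?r j) (\<lambda>z. Z z * k i z - Z z * k a z)"
        using False by (simp add: v_def algebra_simps)
      also have "\<dots> = circle_mean (?c j) (?r j) (\<lambda>z. Z z * k i z) - circle_mean (?c j) (?r j) (\<lambda>z. Z z * k a z)"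
        by (rule circle_mean_lincomb(2)[OF kc[OF ij] kc[OF A(2) ij(2)] sph(2)[OF ij(2)]])
      finally show ?thesis using val[OF ij] val[OF A(2) ij(2)] False by auto
    qed
    moreover have "v i holomorphic_on - A" if "i \<in> A" for i
      unfolding v_def using kh[OF that] kh[OF A(2)] by (cases "i = a") (auto intro!: holomorphic_intros)
    ultimately show ?thesis by blast
  qed
  have "?r i > 0 \<and> sphere (?c i) (?r i) \<inter> A = {}" if "i \<in> A" for i
    using off(1)[OF _ that] offR(1) r(1)[OF that] Rpos by auto
  then show ?thesis unfolding period_system_def using prim dual A(1) by (intro conjI) blast+
qed

text \<open>
  The factor \<open>z - c\<close> of the derivative is replaced by a function \<open>E\<close> without zeros that is close to it on a compact set \<open>H\<close>.
  This \<open>H\<close> contains the circles, so that the periods can be corrected, and the chains of discs from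
  \<open>derivative_controls_values\<close>, so that the primitives are close on \<open>K\<close>.
\<close>

lemma replace_zero_by_unit:
  assumes per: "period_system A ctr rad" and circ: "\<And>i. i \<in> A \<Longrightarrow> sphere (ctr i) (rad i) \<subseteq> D"
    and D: "open D" "connected D" "D \<inter> A = {}" "c \<notin> D" and cA: "c \<notin> A"
    and K: "compact K" "K \<subseteq> D" "K \<noteq> {}"
    and reach: "\<And>H. compact H \<Longrightarrow> H \<subseteq> D \<Longrightarrow> pole_reachable A H c"
    and Z: "Z holomorphic_on UNIV" "\<And>a. a \<in> A \<Longrightarrow> Z a \<noteq> 0"
    and N: "N holomorphic_on - A" "\<And>z. z \<notin> A \<Longrightarrow> N z \<noteq> 0"
    and G: "\<And>z. z \<in> D \<Longrightarrow> (G has_field_derivative (z - c) * Z z * N z) (at z)"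
    and e: "e > 0"
  shows "\<exists>G1 N1. N1 holomorphic_on - A \<and> (\<forall>z. z \<notin> A \<longrightarrow> N1 z \<noteq> 0) \<and>
    (\<forall>z. z \<notin> A \<longrightarrow> (G1 has_field_derivative Z z * N1 z) (at z)) \<and> (\<forall>z\<in>K. norm (G z - G1 z) < e)"
proof -
  have A: "finite A" and rad: "\<And>i. i \<in> A \<Longrightarrow> rad i > 0"
    using per by (auto simp: period_system_def)
  have DA: "D \<subseteq> - A" using D by auto
  obtain x0 where x0: "x0 \<in> K" using K by blast
  then have x0D: "x0 \<in> D" using K by blast
  obtain H0 L where H0: "compact H0" "H0 \<subseteq> D" "L > 0"
    "\<And>F F' e z. (\<And>z. z \<in> D \<Longrightarrow> (F has_field_derivative F' z) (at z)) \<Longrightarrow> F x0 = 0 \<Longrightarrow> e \<ge> 0 \<Longrightarrow>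
       (\<And>z. z \<in> H0 \<Longrightarrow> norm (F' z) \<le> e) \<Longrightarrow> z \<in> K \<Longrightarrow> norm (F z :: complex) \<le> L * e"
    using derivative_controls_values[OF D(1,2) x0D K(1,2)] by metis
  define H where "H = H0 \<union> (\<Union>i\<in>A. sphere (ctr i) (rad i))"
  have H: "compact H" "H0 \<subseteq> H" "\<And>i. i \<in> A \<Longrightarrow> sphere (ctr i) (rad i) \<subseteq> H"
    using H0(1) A by (auto simp: H_def intro!: compact_Un compact_UN)
  have HD: "H \<subseteq> D" using H0(2) circ unfolding H_def by blast
  have HA: "H \<inter> A = {}" "c \<notin> H" using HD D by auto
  define Z' where "Z' z = (z - c) * Z z" for z
  define P where "P z = Z' z * N z" for z
  have Z': "Z' holomorphic_on UNIV" unfolding Z'_def by (intro holomorphic_intros Z)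
  moreover have "\<forall>a\<in>A. Z' a \<noteq> 0" using Z cA by (auto simp: Z'_def)
  ultimately have "\<exists>v. (\<forall>i\<in>A. v i holomorphic_on - A) \<and>
      (\<forall>i\<in>A. \<forall>j\<in>A. circle_mean (ctr j) (rad j) (\<lambda>z. Z' z * v i z) = (if i = j then 1 else 0))"
    using per unfolding period_system_def by blast
  then obtain v where v0: "\<forall>i\<in>A. v i holomorphic_on - A"
    "\<forall>i\<in>A. \<forall>j\<in>A. circle_mean (ctr j) (rad j) (\<lambda>z. Z' z * v i z) = (if i = j then 1 else 0)"
    by (elim exE conjE)
  note v = v0[rule_format]
  \<comment> \<open>Then \<open>P z * u i z = (z - c) * Z z * v i z\<close>, and \<open>u i\<close> is holomorphic off \<open>A\<close> in spite of the zeros of \<open>P\<close>.\<close>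
  define u where "u i z = v i z / N z" for i z
  have uh: "u i holomorphic_on - A" if "i \<in> A" for i
    unfolding u_def by (intro holomorphic_intros v that N) (use N in auto)
  have Ph: "P holomorphic_on - A" unfolding P_def by (intro holomorphic_intros N holomorphic_on_subset[OF Z']) auto
  have HsubA: "H \<subseteq> - A" using HA by auto
  have cont: "continuous_on H g" if "g holomorphic_on - A" for g
    by (intro holomorphic_on_imp_continuous_on holomorphic_on_subset[OF that HsubA])
  obtain B where B: "B > 0" "\<And>z. z \<in> H \<Longrightarrow> norm (P z) \<le> B"
    using compact_imp_bounded[OF compact_continuous_image[OF cont[OF Ph] H(1)]] unfolding bounded_pos by auto
  define \<epsilon> where "\<epsilon> = e / (2 * L * B)"
  have eps: "\<epsilon> > 0" "L * (B * \<epsilon>) < e" using e H0(3) B(1) by (auto simp: \<epsilon>_def)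
  have P0: "circle_mean (ctr j) (rad j) P = 0" if j: "j \<in> A" for j
  proof -
    have "(P has_contour_integral 0) (circlepath (ctr j) (rad j))"
    proof (rule Cauchy_theorem_primitive[where S = D])
      show "(G has_field_derivative P x) (at x within D)" if "x \<in> D" for x
        using G[OF that] by (auto simp: P_def Z'_def intro: has_field_derivative_at_within)
    qed (use circ[OF j] rad[OF j] in auto)
    then show ?thesis by (simp add: circle_mean_def contour_integral_unique)
  qed
  have dual: "circle_mean (ctr j) (rad j) (\<lambda>z. P z * u i z) = (if i = j then 1 else 0)" if "i \<in> A" "j \<in> A" for i j
  proof -
    have "contour_integral (circlepath (ctr j) (rad j)) (\<lambda>z. P z * u i z) = contour_integral (circlepath (ctr j) (rad j)) (\<lambda>z. Z' z * v i z)"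
    proof (rule contour_integral_eq)
      fix z assume "z \<in> path_image (circlepath (ctr j) (rad j))"
      then have "z \<notin> A" using circ[OF that(2)] rad[OF that(2)] DA by auto
      then show "P z * u i z = Z' z * v i z" using N(2) by (simp add: P_def u_def)
    qed
    then show ?thesis using v(2)[OF that] by (simp add: circle_mean_def)
  qed
  have "\<exists>\<delta>>0. \<forall>M. continuous_on H M \<longrightarrow> (\<forall>z\<in>H. norm (M z - 1) \<le> \<delta>) \<longrightarrow>
      (\<exists>t. (\<forall>z\<in>H. norm (M z * exp (\<Sum>i\<in>A. t i * u i z) - 1) \<le> \<epsilon>) \<and>
           (\<forall>j\<in>A. circle_mean (ctr j) (rad j) (\<lambda>z. P z * (M z * exp (\<Sum>i\<in>A. t i * u i z))) = 0))"
    by (rule period_correction[OF A H(1) rad H(3) cont[OF Ph] P0 cont[OF uh] dual eps(1)])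
  then obtain \<delta> where \<delta>: "\<delta> > 0"
    "\<forall>M. continuous_on H M \<longrightarrow> (\<forall>z\<in>H. norm (M z - 1) \<le> \<delta>) \<longrightarrow>
      (\<exists>t. (\<forall>z\<in>H. norm (M z * exp (\<Sum>i\<in>A. t i * u i z) - 1) \<le> \<epsilon>) \<and>
           (\<forall>j\<in>A. circle_mean (ctr j) (rad j) (\<lambda>z. P z * (M z * exp (\<Sum>i\<in>A. t i * u i z))) = 0))"
    by (elim exE conjE)
  obtain E where E: "E holomorphic_on - A" "\<And>z. z \<notin> A \<Longrightarrow> E z \<noteq> 0" "\<And>z. z \<in> H \<Longrightarrow> norm (E z / (z - c) - 1) < \<delta>"
    using linear_factor_unit_approx[OF H(1) HA(1) reach[OF H(1) HD] \<delta>(1)] by blast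
  have "continuous_on H (\<lambda>z. E z / (z - c))"
    by (intro continuous_intros cont E) (use HA in auto)
  moreover have "\<forall>z\<in>H. norm (E z / (z - c) - 1) \<le> \<delta>" using E(3) less_imp_le by blast
  ultimately obtain t where t0: "\<forall>z\<in>H. norm (E z / (z - c) * exp (\<Sum>i\<in>A. t i * u i z) - 1) \<le> \<epsilon>"
    "\<forall>j\<in>A. circle_mean (ctr j) (rad j) (\<lambda>z. P z * (E z / (z - c) * exp (\<Sum>i\<in>A. t i * u i z))) = 0"
    using \<delta>(2)[THEN spec, of "\<lambda>z. E z / (z - c)"] by (elim impE exE conjE)
  note t = t0[rule_format]
  define N1 where "N1 z = N z * E z * exp (\<Sum>i\<in>A. t i * u i z)" for z
  have N1: "N1 holomorphic_on - A" "\<And>z. z \<notin> A \<Longrightarrow> N1 z \<noteq> 0"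
    unfolding N1_def using N E by (auto intro!: holomorphic_intros uh)
  have P_eq: "Z z * N1 z = P z * (E z / (z - c) * exp (\<Sum>i\<in>A. t i * u i z))" if "z \<noteq> c" for z
    using that by (simp add: N1_def P_def Z'_def)
  have "circle_mean (ctr j) (rad j) (\<lambda>z. Z z * N1 z) = 0" if j: "j \<in> A" for j
  proof -
    have "contour_integral (circlepath (ctr j) (rad j)) (\<lambda>z. Z z * N1 z) =
      contour_integral (circlepath (ctr j) (rad j)) (\<lambda>z. P z * (E z / (z - c) * exp (\<Sum>i\<in>A. t i * u i z)))"
    proof (rule contour_integral_eq)
      fix z assume "z \<in> path_image (circlepath (ctr j) (rad j))"
      then have "z \<in> D" using circ[OF j] rad[OF j] by auto
      then have "z \<noteq> c" using D(4) by blast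
      then show "Z z * N1 z = P z * (E z / (z - c) * exp (\<Sum>i\<in>A. t i * u i z))" by (rule P_eq)
    qed
    then show ?thesis using t(2)[OF j] by (simp add: circle_mean_def)
  qed
  moreover have "(\<lambda>z. Z z * N1 z) holomorphic_on - A"
    by (intro holomorphic_intros N1 holomorphic_on_subset[OF Z(1)]) auto
  ultimately have "\<exists>F. \<forall>z. z \<notin> A \<longrightarrow> (F has_field_derivative Z z * N1 z) (at z)"
    using per unfolding period_system_def by blast
  then obtain F where "\<forall>z. z \<notin> A \<longrightarrow> (F has_field_derivative Z z * N1 z) (at z)" ..
  note F = this[rule_format]
  define G1 where "G1 z = F z - F x0 + G x0" for z
  have G1: "(G1 has_field_derivative Z z * N1 z) (at z)" if "z \<notin> A" for z
    unfolding G1_def using F[OF that] by (auto intro!: derivative_eq_intros)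
  have "norm (G z - G1 z) < e" if z: "z \<in> K" for z
  proof -
    have "norm (G1 z - G z) \<le> L * (B * \<epsilon>)"
    proof (rule H0(4)[where F = "\<lambda>z. G1 z - G z" and F' = "\<lambda>z. Z z * N1 z - P z", OF _ _ _ _ z])
      show "((\<lambda>z. G1 z - G z) has_field_derivative Z z * N1 z - P z) (at z)" if "z \<in> D" for z
        using G1[of z] G[OF that] that DA by (auto simp: P_def Z'_def intro!: DERIV_diff)
      show "norm (Z z * N1 z - P z) \<le> B * \<epsilon>" if "z \<in> H0" for z
      proof -
        have zH: "z \<in> H" using that H by blast
        then have "z \<noteq> c" using HA by auto
        have "Z z * N1 z - P z = P z * (E z / (z - c) * exp (\<Sum>i\<in>A. t i * u i z) - 1)"
          unfolding P_eq[OF \<open>z \<noteq> c\<close>] by (simp add: algebra_simps)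
        then show ?thesis unfolding norm_mult[symmetric]
          using B(2)[OF zH] t(1)[OF zH] B(1) by (simp add: norm_mult mult_mono)
      qed
    qed (use B eps in \<open>auto simp: G1_def\<close>)
    then show ?thesis using eps(2) by (simp add: norm_minus_commute)
  qed
  then show ?thesis using N1 G1 by (intro exI[of _ G1] exI[of _ N1]) simp
qed

text \<open>
  The two cases send \<open>c\<close> to infinity or to a point \<open>a\<close> off \<open>\<Omega>\<close>. In the latter case \<open>a\<close> joins the exceptional set, where the new
  function may have an essential singularity.
\<close>

lemma remove_zero:
  assumes K: "compact K" "K \<noteq> {}" "K \<subseteq> \<Omega>"
    and good: "\<And>w. w \<notin> K \<Longrightarrow> connected_component_set (- K) w \<inter> - \<Omega> \<noteq> {} \<or> \<not> bounded (connected_component_set (- K) w)"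
    and A: "finite A" "A \<inter> \<Omega> = {}" and c: "c \<in> \<Omega>" "c \<notin> K"
    and Z: "Z holomorphic_on UNIV" "\<And>z. z \<notin> \<Omega> \<Longrightarrow> Z z \<noteq> 0"
    and N: "N holomorphic_on - A" "\<And>z. z \<notin> A \<Longrightarrow> N z \<noteq> 0"
    and G: "\<And>z. z \<notin> A \<Longrightarrow> (G has_field_derivative (z - c) * Z z * N z) (at z)"
    and e: "e > 0"
  obtains A1 G1 N1 where "finite A1" "A1 \<inter> \<Omega> = {}" "N1 holomorphic_on - A1" "\<And>z. z \<notin> A1 \<Longrightarrow> N1 z \<noteq> 0"
    "\<And>z. z \<notin> A1 \<Longrightarrow> (G1 has_field_derivative Z z * N1 z) (at z)" "\<And>z. z \<in> K \<Longrightarrow> norm (G z - G1 z) < e"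
proof (cases "bounded (connected_component_set (- K) c)")
  case True
  then obtain a where a: "connected_component (- K) c a" "a \<notin> \<Omega>" using good[OF c(2)] by auto
  define A1 where "A1 = insert a A"
  have A1: "finite A1" "A1 \<inter> \<Omega> = {}" "a \<in> A1" "A \<subseteq> A1" using A a by (auto simp: A1_def)
  have "a \<noteq> c" "c \<notin> A1" and A1K: "K \<inter> A1 = {}" using a c A1 K by auto
  obtain D T where D: "open D" "connected D" "K \<subseteq> D" "D \<inter> A1 = {}" "c \<notin> D"
    "\<And>b. b \<in> A1 \<Longrightarrow> b \<noteq> a \<Longrightarrow> \<exists>r>0. cball b r - {b} \<subseteq> D"
    "bounded (- D)" "connected T" "c \<in> T" "a \<in> T" "T \<inter> D = {}"
    using cut_to_finite_point[OF K(1) A1(1) A1K c(2) \<open>c \<notin> A1\<close> a(1) \<open>a \<noteq> c\<close> A1(3)] by metis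
  have "\<exists>r. \<forall>b\<in>A1 - {a}. r b > 0 \<and> cball b (r b) - {b} \<subseteq> D"
    by (rule bchoice[of "A1 - {a}" "\<lambda>b r. r > 0 \<and> cball b r - {b} \<subseteq> D"]) (use D(6) in auto)
  then obtain r where r0: "\<forall>b\<in>A1 - {a}. r b > 0 \<and> cball b (r b) - {b} \<subseteq> D" ..
  have r: "r b > 0" "cball b (r b) - {b} \<subseteq> D" if "b \<in> A1" "b \<noteq> a" for b
    using r0 that by auto
  obtain R0 where R0: "\<forall>z\<in>- D. norm z \<le> R0" using D(7) unfolding bounded_iff ..
  define R where "R = R0 + 1"
  have R: "z \<in> D" if "norm z \<ge> R" for z using R0 that by (force simp: R_def)
  have A1R: "A1 \<subseteq> ball 0 R" using R D(4) by (force simp: not_le[symmetric])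
  have rA: "cball b (r b) \<inter> A1 = {b}" if "b \<in> A1" "b \<noteq> a" for b
    using r(1,2)[OF that] D(4) that by auto
  have per: "period_system A1 (\<lambda>b. if b = a then 0 else b) (\<lambda>b. if b = a then R else r b)"
    by (rule period_system_outer_circle) (fact A1(1,3) r(1) rA A1R)+
  have "\<exists>G1 N1. N1 holomorphic_on - A1 \<and> (\<forall>z. z \<notin> A1 \<longrightarrow> N1 z \<noteq> 0) \<and>
    (\<forall>z. z \<notin> A1 \<longrightarrow> (G1 has_field_derivative Z z * N1 z) (at z)) \<and> (\<forall>z\<in>K. norm (G z - G1 z) < e)"
  proof (rule replace_zero_by_unit[OF per, of D c K Z N G e])
    show "sphere (if i = a then 0 else i) (if i = a then R else r i) \<subseteq> D" if "i \<in> A1" for i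
    proof (cases "i = a")
      case False
      have "sphere i (r i) \<subseteq> cball i (r i) - {i}" using r(1)[OF that False] by auto
      then show ?thesis using r(2)[OF that False] False by simp
    qed (use R in auto)
    show "pole_reachable A1 H c" if "compact H" "H \<subseteq> D" for H
      unfolding pole_reachable_def using D A1(3) that by (intro exI[of _ T]) auto
    show "N holomorphic_on - A1" by (rule holomorphic_on_subset[OF N(1)]) (use A1 in auto)
    show "(G has_field_derivative (z - c) * Z z * N z) (at z)" if "z \<in> D" for z
      using G[of z] that D(4) A1(4) by auto
    show "Z b \<noteq> 0" if "b \<in> A1" for b using Z(2)[of b] that A1(2) by auto
    show "N z \<noteq> 0" if "z \<notin> A1" for z using N(2)[of z] that A1(4) by auto
  qed (fact D(1,2,4,5) \<open>c \<notin> A1\<close> K(1,2) D(3) Z(1) e)+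
  then obtain G1 N1 where 1: "N1 holomorphic_on - A1" "\<forall>z. z \<notin> A1 \<longrightarrow> N1 z \<noteq> 0"
    "\<forall>z. z \<notin> A1 \<longrightarrow> (G1 has_field_derivative Z z * N1 z) (at z)" "\<forall>z\<in>K. norm (G z - G1 z) < e"
    by (elim exE conjE)
  show ?thesis by (rule that[OF A1(1,2) 1(1)]) (use 1(2-4) in auto)
next
  case False
  have cA: "c \<notin> A" and AK: "K \<inter> A = {}" using c A K by auto
  obtain D T where D: "open D" "connected D" "K \<subseteq> D" "D \<inter> A = {}" "c \<notin> D"
    "\<And>b. b \<in> A \<Longrightarrow> \<exists>r>0. cball b r - {b} \<subseteq> D"
    "connected T" "c \<in> T" "\<not> bounded T" "T \<inter> D = {}"
    using cut_to_infinity[OF K(1) A(1) AK c(2) cA False] by metis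
  obtain r where r: "\<And>b. b \<in> A \<Longrightarrow> r b > 0" "\<And>b. b \<in> A \<Longrightarrow> cball b (r b) - {b} \<subseteq> D"
    using D(6) by metis
  have rA: "cball b (r b) \<inter> A = {b}" if "b \<in> A" for b
    using r(1,2)[OF that] D(4) that by auto
  have per: "period_system A (\<lambda>b. b) r"
    by (rule period_system_small_circles) (fact A(1) r(1) rA)+
  have "\<exists>G1 N1. N1 holomorphic_on - A \<and> (\<forall>z. z \<notin> A \<longrightarrow> N1 z \<noteq> 0) \<and>
    (\<forall>z. z \<notin> A \<longrightarrow> (G1 has_field_derivative Z z * N1 z) (at z)) \<and> (\<forall>z\<in>K. norm (G z - G1 z) < e)"
  proof (rule replace_zero_by_unit[OF per, of D c K Z N G e])
    show "sphere i (r i) \<subseteq> D" if "i \<in> A" for i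
    proof -
      have "sphere i (r i) \<subseteq> cball i (r i) - {i}" using r(1)[OF that] by auto
      then show ?thesis using r(2)[OF that] by blast
    qed
    show "pole_reachable A H c" if H: "compact H" "H \<subseteq> D" for H
    proof -
      obtain B where B: "\<forall>z\<in>H. norm z \<le> B" using compact_imp_bounded[OF H(1)] unfolding bounded_iff ..
      obtain b where "b \<in> T" "norm b > 2 * B" using D(9) unfolding bounded_iff by (meson not_le)
      then have "\<forall>z\<in>H. 2 * norm z < norm b" using B by force
      then show ?thesis unfolding pole_reachable_def using D(7,8,10) H(2) \<open>b \<in> T\<close> by (intro exI[of _ T]) auto
    qed
    show "(G has_field_derivative (z - c) * Z z * N z) (at z)" if "z \<in> D" for z
      using G[of z] that D(4) by auto
    show "Z b \<noteq> 0" if "b \<in> A" for b using Z(2)[of b] that A(2) by auto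
    show "N z \<noteq> 0" if "z \<notin> A" for z using N(2)[of z] that by auto
  qed (fact D(1,2,4,5) cA K(1,2) D(3) Z(1) N(1) e)+
  then obtain G1 N1 where 1: "N1 holomorphic_on - A" "\<forall>z. z \<notin> A \<longrightarrow> N1 z \<noteq> 0"
    "\<forall>z. z \<notin> A \<longrightarrow> (G1 has_field_derivative Z z * N1 z) (at z)" "\<forall>z\<in>K. norm (G z - G1 z) < e"
    by (elim exE conjE)
  show ?thesis by (rule that[OF A 1(1)]) (use 1(2-4) in auto)
qed

lemma remove_all_zeros:
  assumes \<Omega>: "open \<Omega>" and K: "compact K" "K \<noteq> {}" "K \<subseteq> \<Omega>"
    and good: "\<And>w. w \<notin> K \<Longrightarrow> connected_component_set (- K) w \<inter> - \<Omega> \<noteq> {} \<or> \<not> bounded (connected_component_set (- K) w)"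
    and A: "finite A" "A \<inter> \<Omega> = {}" and cs: "set cs \<subseteq> \<Omega> - K"
    and N: "N holomorphic_on - A" "\<And>z. z \<notin> A \<Longrightarrow> N z \<noteq> 0"
    and G: "\<And>z. z \<notin> A \<Longrightarrow> (G has_field_derivative (\<Prod>c\<leftarrow>cs. z - c) * N z) (at z)"
    and e: "e > 0"
  shows "\<exists>g. g holomorphic_on \<Omega> \<and> (\<forall>z\<in>\<Omega>. deriv g z \<noteq> 0) \<and> (\<forall>z\<in>K. norm (G z - g z) < e)"
  using A cs N G e
proof (induction cs arbitrary: A N G e)
  case Nil
  then have G: "(G has_field_derivative N z) (at z)" and nz: "N z \<noteq> 0" if "z \<in> \<Omega>" for z
    using that by (auto simp: disjoint_iff)
  have "G holomorphic_on \<Omega>" unfolding holomorphic_on_open[OF \<Omega>] using G by blast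
  moreover have "deriv G z \<noteq> 0" if "z \<in> \<Omega>" for z using DERIV_imp_deriv[OF G[OF that]] nz[OF that] by simp
  ultimately show ?case using Nil.prems(7) by (intro exI[of _ G]) simp
next
  case (Cons c cs)
  define Z where "Z z = (\<Prod>c\<leftarrow>cs. z - c)" for z :: complex
  have Zh: "Z holomorphic_on UNIV"
    unfolding Z_def by (induction cs) (auto intro!: holomorphic_intros)
  have Z0: "Z z \<noteq> 0" if "z \<notin> \<Omega>" for z using Cons.prems(3) that by (auto simp: Z_def prod_list_zero_iff)
  have e2: "e / 2 > 0" using Cons.prems by simp
  have Gd: "(G has_field_derivative (z - c) * Z z * N z) (at z)" if "z \<notin> A" for z
    using Cons.prems(6)[OF that] by (simp add: Z_def)
  have c: "c \<in> \<Omega>" "c \<notin> K" using Cons.prems(3) by auto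
  obtain A1 G1 N1 where 1: "finite A1" "A1 \<inter> \<Omega> = {}" "N1 holomorphic_on - A1" "\<And>z. z \<notin> A1 \<Longrightarrow> N1 z \<noteq> 0"
    "\<And>z. z \<notin> A1 \<Longrightarrow> (G1 has_field_derivative Z z * N1 z) (at z)" "\<And>z. z \<in> K \<Longrightarrow> norm (G z - G1 z) < e / 2"
    using remove_zero[OF K good Cons.prems(1,2) c Zh Z0 Cons.prems(4,5) Gd e2] by metis
  have "\<exists>g. g holomorphic_on \<Omega> \<and> (\<forall>z\<in>\<Omega>. deriv g z \<noteq> 0) \<and> (\<forall>z\<in>K. norm (G1 z - g z) < e / 2)"
    by (rule Cons.IH[OF 1(1,2) _ 1(3,4)]) (use 1(5) Cons.prems(3) e2 in \<open>auto simp: Z_def\<close>)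
  then obtain g where g: "g holomorphic_on \<Omega>" "\<forall>z\<in>\<Omega>. deriv g z \<noteq> 0" "\<And>z. z \<in> K \<Longrightarrow> norm (G1 z - g z) < e / 2"
    by blast
  have "norm (G z - g z) < e" if "z \<in> K" for z
    using norm_triangle_ineq[of "G z - G1 z" "G1 z - g z"] 1(6)[OF that] g(3)[OF that] by simp
  then show ?case using g by blast
qed

section \<open>Local univalence on the whole domain\<close>

text \<open>
  A bounded component of \<open>- K\<close> inside \<open>\<Omega>\<close> would be a component of \<open>\<Omega> - K\<close>, and its closure, which adds only
  points of \<open>K\<close>, would be a compact subset of \<open>\<Omega>\<close>.
\<close>

lemma complement_component_escapes:
  fixes \<Omega> K :: "complex set"
  assumes K: "compact K" "K \<subseteq> \<Omega>"
    and no: "\<not> (\<exists>C \<in> components (\<Omega> - K). relatively_compact_in \<Omega> C)" and w: "w \<notin> K"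
  shows "connected_component_set (- K) w \<inter> - \<Omega> \<noteq> {} \<or> \<not> bounded (connected_component_set (- K) w)"
proof (rule ccontr)
  define C where "C = connected_component_set (- K) w"
  assume "\<not> (connected_component_set (- K) w \<inter> - \<Omega> \<noteq> {} \<or> \<not> bounded (connected_component_set (- K) w))"
  then have C: "C \<subseteq> \<Omega>" "bounded C" by (auto simp: C_def)
  have CK: "C \<subseteq> - K" unfolding C_def by (rule connected_component_subset)
  have wC: "w \<in> C" using w by (simp add: C_def)
  have "C = connected_component_set (\<Omega> - K) w"
  proof
    show "C \<subseteq> connected_component_set (\<Omega> - K) w"
      by (rule connected_component_maximal) (use wC C CK in \<open>auto simp: C_def\<close>)
    show "connected_component_set (\<Omega> - K) w \<subseteq> C"
      unfolding C_def by (rule connected_component_mono) auto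
  qed
  then have "C \<in> components (\<Omega> - K)" using wC C CK by (auto simp: components_def)
  moreover have "relatively_compact_in \<Omega> C"
    unfolding relatively_compact_in_iff
  proof
    show "compact (closure C)" using C by (simp add: compact_closure)
    have "closedin (top_of_set (- K)) C" unfolding C_def by (rule closedin_connected_component)
    then obtain T where T: "closed T" "C = - K \<inter> T" by (auto simp: closedin_closed)
    then have "closure C \<subseteq> T" by (intro closure_minimal) auto
    then show "closure C \<subseteq> \<Omega>" using T(2) C(1) K(2) by blast
  qed
  ultimately show False using no by blast
qed

theorem theorem1p1:
  fixes \<Omega> K :: "complex set" and f :: "complex \<Rightarrow> complex"
  assumes "open \<Omega>" and "connected \<Omega>" and "\<Omega> \<noteq> {}"
    and "compact K" and "K \<subseteq> \<Omega>"
    and "\<not> (\<exists>C \<in> components (\<Omega> - K). relatively_compact_in \<Omega> C)"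
    and "f \<in> H_lu K"
  shows "\<forall>\<epsilon>>0. \<exists>g \<in> H_lu \<Omega>. \<forall>z\<in>K. norm (f z - g z) < \<epsilon>"
proof (intro allI impI)
  fix \<epsilon> :: real assume eps: "\<epsilon> > 0"
  show "\<exists>g \<in> H_lu \<Omega>. \<forall>z\<in>K. norm (f z - g z) < \<epsilon>"
  proof (cases "K = {}")
    case True
    have "(\<lambda>z. z) \<in> H_lu \<Omega>" using assms(1) by (simp add: H_lu_open)
    then show ?thesis using True by blast
  next
    case False
    note good = complement_component_escapes[OF assms(4,5,6)]
    obtain U where U: "open U" "K \<subseteq> U" "f holomorphic_on U" "\<And>z. z \<in> U \<Longrightarrow> deriv f z \<noteq> 0"
      using assms(7) by (auto simp: H_lu_def)
    have A: "closed (- \<Omega>)" "K \<inter> - \<Omega> = {}" using assms(1,5) by auto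
    have e2: "\<epsilon> / 2 > 0" using eps by simp
    obtain r where r: "r \<in> rational_off (- \<Omega>)" "\<And>z. z \<in> K \<Longrightarrow> norm (f z - r z) < \<epsilon> / 2" "\<And>z. z \<in> K \<Longrightarrow> deriv r z \<noteq> 0"
      by (rule locally_univalent_rational_approx[OF assms(4) False A U good e2]) (rule that | assumption)+
    obtain A0 G N cs where G: "finite A0" "A0 \<subseteq> - \<Omega>" "set cs \<inter> - \<Omega> = {}" "set cs \<inter> K = {}"
      "N holomorphic_on - A0" "\<And>z. z \<notin> A0 \<Longrightarrow> N z \<noteq> 0"
      "\<And>z. z \<notin> A0 \<Longrightarrow> (G has_field_derivative (\<Prod>c\<leftarrow>cs. z - c) * N z) (at z)"
      "\<And>z. z \<notin> - \<Omega> \<Longrightarrow> G z = r z"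
      by (rule rational_derivative_factorization[OF r(1) A(1) False A(2) r(3)]) (rule that | assumption)+
    have A0: "A0 \<inter> \<Omega> = {}" "set cs \<subseteq> \<Omega> - K" using G(2-4) by auto
    have "\<exists>g. g holomorphic_on \<Omega> \<and> (\<forall>z\<in>\<Omega>. deriv g z \<noteq> 0) \<and> (\<forall>z\<in>K. norm (G z - g z) < \<epsilon> / 2)"
      by (rule remove_all_zeros[OF assms(1,4) False assms(5) good G(1) A0(1) A0(2) G(5,6,7) e2])
    then obtain g where g: "g holomorphic_on \<Omega>" "\<forall>z\<in>\<Omega>. deriv g z \<noteq> 0" "\<forall>z\<in>K. norm (G z - g z) < \<epsilon> / 2"
      by (elim exE conjE)
    have "norm (f z - g z) < \<epsilon>" if z: "z \<in> K" for z
    proof -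
      have "G z = r z" using G(8)[of z] z assms(5) by blast
      then show ?thesis
        using norm_triangle_ineq[of "f z - r z" "r z - g z"] r(2)[OF z] g(3) z by force
    qed
    moreover have "g \<in> H_lu \<Omega>" using g assms(1) by (simp add: H_lu_open)
    ultimately show ?thesis by blast
  qed
qed

end
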